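(* Let $x_1,\dots,x_n\in\mathbb{R}^p$ be fixed with $n^{-1}\sum_{i=1}^nx_{ij}^2=1$ $(j=1,\dots,p)$, let $\epsilon_1,\dots,\epsilon_n$ be i.i.d. with law $F_0$ having mean $0$ and variance $1$, let $\Lambda=n\|E_n(x\epsilon)\|_\infty/\{E_n(\epsilon^2)\}^{1/2}$, and let $c>1$, $0<\alpha<1$. (i) If $F_0=F$, the exact option $\lambda=c\,\Lambda_F(1-\alpha\mid X)$ satisfies $\lambda\ge c\Lambda$ with probability at least $1-\alpha$. (ii) If either $F_0\in\mathcal F$ or $\Lambda_F(1-\alpha\mid X)\ge\Lambda_{F_0}(1-\alpha\mid X)$ for some $F\in\mathcal F$, the semi-exact option $\lambda=c\max_{F\in\mathcal F}\Lambda_F(1-\alpha\mid X)$ satisfies $\lambda\ge c\Lambda$ with probability at least $1-\alpha$. Suppose further that, as $n\to\infty$, the following conditions hold: (M) there exists a finite constant $q>2$ such that $F_0\in\mathcal F$, $\sup_{n\ge1}\sup_{F\in\mathcal F}E_F(|\epsilon|^q)<\infty$, and $\sup_{n\ge1,\,1\le j\le p}n^{-1}\sum_{i=1}^n|x_{ij}|^q<\infty$; (R) $p\le\alpha n^{\eta(q-2)/2}/2$ for some constant $0<\eta<1$, and $\alpha^{-1}=o\big[n^{\{(q/2-1)\wedge(q/4)\}\vee(q/2-2)}/(\log n)^{q/2}\big]$. Then: (iii) the asymptotic option $\lambda=c\,\Lambda(1-\alpha)=c\,n^{1/2}\Phi^{-1}(1-\alpha/2p)$ satisfies $\lambda\ge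 c\Lambda$ with probability at least $1-\alpha-o(\alpha)$; and (iv) as $n\to\infty$, $$\max_{F\in\mathcal F}\Lambda_F(1-\alpha\mid X)\le\Lambda(1-\alpha)\{1+o(1)\}\le\{2n\log(2p/\alpha)\}^{1/2}\{1+o(1)\}.$$
   Context: Notation: $E_n(f)=n^{-1}\sum_{i=1}^nf(z_i)$, e.g. $E_n(x\epsilon)=n^{-1}\sum_ix_i\epsilon_i\in\mathbb{R}^p$; $E_F$ is expectation when $\epsilon$ has law $F$; $\Phi$ is the standard normal distribution function; $a\wedge b=\min(a,b)$, $a\vee b=\max(a,b)$. $\mathcal F$ is a family of laws on $\mathbb{R}$, each with mean $0$ and variance $1$, finite or more generally such that the maximum over $\mathcal F$ below is well defined. For a law $F$, $\Lambda_F(1-\alpha\mid X)$ is the $(1-\alpha)$-quantile, for the fixed design $X$, of $\Lambda_F=n\|E_n(x\xi)\|_\infty/\{E_n(\xi^2)\}^{1/2}$, where $\xi_1,\dots,\xi_n$ are i.i.d. with law $F$. Ratios with zero denominator are taken to be $0$. Also $\Lambda(1-\alpha)=n^{1/2}\Phi^{-1}(1-\alpha/2p)$. Asymptotics: in (iii)–(iv), $n\to\infty$, $p=p_n\to\infty$, and the design, $F_0$ and $\alpha=\alpha_n$ may depend on $n$; $\alpha$ is bounded away from $1$ but may approach $0$. $o(\cdot)$ is with respect to $n\to\infty$. *)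

theory Defs
  imports "HOL-Probability.Probability" "HOL-Library.Landau_Symbols"
begin

definition empirical_mean :: "nat \<Rightarrow> (nat \<Rightarrow> real) \<Rightarrow> real" where
  "empirical_mean n f = (\<Sum>i=1..n. f i) / real n"

text \<open>Vectors in \<open>\<real>\<^sup>p\<close> are functions on \<open>{1..p}\<close>; values outside this range are ignored.\<close>

definition sup_norm :: "nat \<Rightarrow> (nat \<Rightarrow> real) \<Rightarrow> real" where
  "sup_norm p v = (MAX j\<in>{1..p}. \<bar>v j\<bar>)"

text \<open>
  The entry \<open>x i j\<close> is the \<open>j\<close>-th component of the design point \<open>x\<^sub>i\<close>.
  When the denominator is zero, HOL division already gives the required value \<open>0\<close>.
\<close>

definition score_stat :: "nat \<Rightarrow> nat \<Rightarrow> (nat \<Rightarrow> nat \<Rightarrow> real) \<Rightarrow> (nat \<Rightarrow> real) \<Rightarrow> real" where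
  "score_stat n p x e =
     real n * sup_norm p (\<lambda>j. empirical_mean n (\<lambda>i. x i j * e i))
       / sqrt (empirical_mean n (\<lambda>i. (e i)\<^sup>2))"

definition standardized_law :: "real measure \<Rightarrow> bool" where
  "standardized_law F \<longleftrightarrow>
     real_distribution F \<and>
     integrable F (\<lambda>t. t) \<and> integrable F (\<lambda>t. t\<^sup>2) \<and>
     prob_space.expectation F (\<lambda>t. t) = 0 \<and>
     prob_space.variance F (\<lambda>t. t) = 1"

definition quantile :: "real measure \<Rightarrow> real \<Rightarrow> real" where
  "quantile D u = Inf {t. u \<le> cdf D t}"

definition score_quantile ::
  "nat \<Rightarrow> nat \<Rightarrow> (nat \<Rightarrow> nat \<Rightarrow> real) \<Rightarrow> real measure \<Rightarrow> real \<Rightarrow> real" where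
  "score_quantile n p x F u =
     quantile (distr (\<Pi>\<^sub>M i\<in>{1..n}. F) borel (score_stat n p x)) u"

text \<open>
  The family need not be finite, but the maximum of the quantiles over it has to be attained;
  for a finite family this just says that the family is nonempty.
\<close>

definition max_well_defined ::
  "nat \<Rightarrow> nat \<Rightarrow> (nat \<Rightarrow> nat \<Rightarrow> real) \<Rightarrow> real measure set \<Rightarrow> real \<Rightarrow> bool" where
  "max_well_defined n p x \<F> u \<longleftrightarrow>
     (\<exists>F\<in>\<F>. \<forall>G\<in>\<F>. score_quantile n p x G u \<le> score_quantile n p x F u)"

definition max_score_quantile ::
  "nat \<Rightarrow> nat \<Rightarrow> (nat \<Rightarrow> nat \<Rightarrow> real) \<Rightarrow> real measure set \<Rightarrow> real \<Rightarrow> real" where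
  "max_score_quantile n p x \<F> u = (GREATEST l. l \<in> (\<lambda>F. score_quantile n p x F u) ` \<F>)"

text \<open>\<open>inv\<close> is only meaningful on the range of \<open>\<Phi>\<close>, the open interval \<open>(0, 1)\<close>.\<close>

definition std_normal_quantile :: "real \<Rightarrow> real" where
  "std_normal_quantile = inv (cdf std_normal_distribution)"

definition asymptotic_quantile :: "nat \<Rightarrow> nat \<Rightarrow> real \<Rightarrow> real" where
  "asymptotic_quantile n p \<alpha> = sqrt (real n) * std_normal_quantile (1 - \<alpha> / (2 * real p))"

definition normalized_design :: "nat \<Rightarrow> nat \<Rightarrow> (nat \<Rightarrow> nat \<Rightarrow> real) \<Rightarrow> bool" where
  "normalized_design n p x \<longleftrightarrow>
     n \<ge> 1 \<and> p \<ge> 1 \<and> (\<forall>j\<in>{1..p}. empirical_mean n (\<lambda>i. (x i j)\<^sup>2) = 1)"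

definition iid_sample :: "'a measure \<Rightarrow> nat \<Rightarrow> (nat \<Rightarrow> 'a \<Rightarrow> real) \<Rightarrow> real measure \<Rightarrow> bool" where
  "iid_sample M n \<epsilon> F \<longleftrightarrow>
     prob_space M \<and>
     prob_space.indep_vars M (\<lambda>_. borel) \<epsilon> {1..n} \<and>
     (\<forall>i\<in>{1..n}. distr M borel (\<epsilon> i) = F)"

definition regression_model ::
  "'a measure \<Rightarrow> nat \<Rightarrow> nat \<Rightarrow> (nat \<Rightarrow> nat \<Rightarrow> real) \<Rightarrow> (nat \<Rightarrow> 'a \<Rightarrow> real) \<Rightarrow> real measure \<Rightarrow> bool"
where
  "regression_model M n p x \<epsilon> F\<^sub>0 \<longleftrightarrow>
     normalized_design n p x \<and> standardized_law F\<^sub>0 \<and> iid_sample M n \<epsilon> F\<^sub>0"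

definition law_family ::
  "nat \<Rightarrow> nat \<Rightarrow> (nat \<Rightarrow> nat \<Rightarrow> real) \<Rightarrow> real measure set \<Rightarrow> real \<Rightarrow> bool" where
  "law_family n p x \<F> u \<longleftrightarrow> (\<forall>F\<in>\<F>. standardized_law F) \<and> max_well_defined n p x \<F> u"

text \<open>
  In the asymptotic conditions the family, like all other ingredients, may vary with \<open>n\<close>.
  The moments are taken in the extended nonnegative reals, so no integrability is presupposed.
\<close>

definition moment_condition ::
  "real \<Rightarrow> (nat \<Rightarrow> nat) \<Rightarrow> (nat \<Rightarrow> nat \<Rightarrow> nat \<Rightarrow> real) \<Rightarrow> (nat \<Rightarrow> real measure) \<Rightarrow>
    (nat \<Rightarrow> real measure set) \<Rightarrow> bool" where
  "moment_condition q p x F\<^sub>0 \<F> \<longleftrightarrow>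
     q > 2 \<and>
     (\<forall>n\<ge>1. F\<^sub>0 n \<in> \<F> n) \<and>
     (SUP n\<in>{1..}. SUP F\<in>\<F> n. \<integral>\<^sup>+ t. ennreal (\<bar>t\<bar> powr q) \<partial>F) < \<infinity> \<and>
     (SUP n\<in>{1..}. SUP j\<in>{1..p n}. ennreal (empirical_mean n (\<lambda>i. \<bar>x n i j\<bar> powr q))) < \<infinity>"

text \<open>
  The bound on \<open>p\<close> can only be required for large \<open>n\<close>: at \<open>n = 1\<close> it would force \<open>p < 1\<close>.
\<close>

definition rate_condition :: "real \<Rightarrow> (nat \<Rightarrow> nat) \<Rightarrow> (nat \<Rightarrow> real) \<Rightarrow> bool" where
  "rate_condition q p \<alpha> \<longleftrightarrow>
     (\<exists>\<eta>. 0 < \<eta> \<and> \<eta> < 1 \<and>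
        (\<forall>\<^sub>F n in sequentially. real (p n) \<le> \<alpha> n * real n powr (\<eta> * (q - 2) / 2) / 2)) \<and>
     (\<lambda>n. inverse (\<alpha> n)) \<in>
       o(\<lambda>n. real n powr max (min (q / 2 - 1) (q / 4)) (q / 2 - 2) / ln (real n) powr (q / 2))"

end

theory Submission
  imports Defs "HOL-Real_Asymp.Real_Asymp"
begin

text \<open>
  Parts (i) and (ii) only use that a distribution function is at least \<open>u\<close> at its \<open>u\<close>-quantile.

  For (iii), let \<open>t = \<Phi>\<inverse>(1 - \<alpha>/2p)\<close>. Up to an event on which \<open>E\<^sub>n(\<epsilon>\<^sup>2) \<le> 1 - r\<close>, whose
  probability is at most \<open>exp (- n powr (1/4) / 2)\<close> for \<open>r\<close> a small negative power of \<open>n\<close>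
  (the lower tail of a sum of nonnegative variables is exponentially small), a union bound reduces
  the claim to a sharp moderate deviation bound for each of the \<open>2p\<close> sums
  \<open>S = \<plusminus> \<Sum>\<^sub>i x\<^sub>i\<^sub>j \<epsilon>\<^sub>i / sqrt n\<close> at level \<open>u = (1 - r) t\<close>. The summands are truncated
  at a small negative power \<open>b\<close> of \<open>n\<close>, and \<open>P(S \<ge> u)\<close> is bounded by \<open>E \<Phi>((S - u + h)/d)\<close>.
  The function \<open>\<Phi>(y / sqrt v)\<close> solves the heat equation, so replacing a summand by an increase of
  \<open>v\<close> by its variance (Lindeberg's method) costs only a third order Taylor remainder.
  Every derivative is dominated by the exponential weight \<open>exp (u y + u\<^sup>2 v / 2)\<close>, so that the total
  error is a Chernoff bound \<open>exp (- t\<^sup>2/2)\<close> times a negative power of \<open>n\<close>. It is therefore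
  negligible against \<open>1 - \<Phi> t\<close>, since \<open>t\<^sup>2\<close> grows at most like \<open>ln n\<close>.

  Part (iv) is the same bound at level \<open>\<alpha>/2\<close> for the maximizing law, together with
  \<open>\<Phi>\<inverse>(1 - \<alpha>/4p) \<sim> \<Phi>\<inverse>(1 - \<alpha>/2p)\<close>.
\<close>

subsection \<open>The standard normal distribution function\<close>

definition std_normal_cdf :: "real \<Rightarrow> real" ("\<Phi>") where
  "\<Phi> = cdf std_normal_distribution"

abbreviation std_normal_pdf :: "real \<Rightarrow> real" ("\<phi>") where
  "\<phi> \<equiv> std_normal_density"

interpretation std_normal: real_distribution std_normal_distribution
  by (rule real_dist_normal_dist)

lemma std_normal_cdf_nonneg [simp]: "0 \<le> \<Phi> t"
  and std_normal_cdf_le_1 [simp]: "\<Phi> t \<le> 1"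
  and std_normal_cdf_mono: "a \<le> b \<Longrightarrow> \<Phi> a \<le> \<Phi> b"
  and std_normal_cdf_at_bot: "(\<Phi> \<longlongrightarrow> 0) at_bot"
  and std_normal_cdf_at_top: "(\<Phi> \<longlongrightarrow> 1) at_top"
  unfolding std_normal_cdf_def
  by (auto intro: std_normal.cdf_nonneg std_normal.cdf_bounded_prob std_normal.cdf_nondecreasing
      std_normal.cdf_lim_at_bot std_normal.cdf_lim_at_top_prob)

lemma std_normal_cdf_diff:
  assumes "a < b"
  shows "\<Phi> b - \<Phi> a = integral {a..b} \<phi>"
proof -
  have cont: "continuous_on {a..b} \<phi>"
    by (auto simp: std_normal_density_def intro!: continuous_intros)
  have hi: "(\<phi> has_integral integral {a..b} \<phi>) {a..b}"
    using cont by (intro integrable_integral integrable_continuous_interval)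
  have nn: "0 \<le> integral {a..b} \<phi>"
    by (rule integral_nonneg) (use hi in \<open>auto simp: has_integral_integrable\<close>)
  have "emeasure std_normal_distribution {a<..b} = (\<integral>\<^sup>+x. ennreal (\<phi> x) * indicator {a<..b} x \<partial>lborel)"
    by (subst emeasure_density) auto
  also have "\<dots> = (\<integral>\<^sup>+x. ennreal (\<phi> x) * indicator {a..b} x \<partial>lborel)"
    by (intro nn_integral_cong_AE AE_I[where N="{a}"]) (auto simp: indicator_def)
  also have "\<dots> = (\<integral>\<^sup>+x. ennreal (if x \<in> {a..b} then \<phi> x else 0) \<partial>lborel)"
    by (intro nn_integral_cong) (auto simp: indicator_def)
  also have "\<dots> = ennreal (integral {a..b} \<phi>)"
    using hi has_integral_restrict_UNIV[of "{a..b}" \<phi> "integral {a..b} \<phi>"]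
    by (intro nn_integral_has_integral_lborel) auto
  finally have "measure std_normal_distribution {a<..b} = integral {a..b} \<phi>"
    using nn by (simp add: measure_def)
  then show ?thesis
    using std_normal.cdf_diff_eq[OF assms] by (simp add: std_normal_cdf_def)
qed

lemma std_normal_cdf_deriv:
  "(\<Phi> has_real_derivative \<phi> t) (at t)"
proof -
  have cont: "continuous_on {t-1..t+1} \<phi>"
    by (auto simp: std_normal_density_def intro!: continuous_intros)
  have "((\<lambda>y. integral {t-1..y} \<phi>) has_real_derivative \<phi> t) (at t within {t-1..t+1})"
    by (rule integral_has_real_derivative[OF cont]) auto
  then have "((\<lambda>y. integral {t-1..y} \<phi>) has_real_derivative \<phi> t) (at t)"
    by (subst (asm) at_within_interior) auto
  then have "((\<lambda>y. \<Phi> (t-1) + integral {t-1..y} \<phi>) has_real_derivative \<phi> t) (at t)"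
    by (auto intro!: derivative_eq_intros)
  moreover have "\<forall>\<^sub>F y in nhds t. \<Phi> (t-1) + integral {t-1..y} \<phi> = \<Phi> y"
    using eventually_nhds_in_open[of "{t-1<..}" t]
    by (auto elim!: eventually_mono simp: std_normal_cdf_diff[symmetric])
  ultimately show ?thesis
    by (subst (asm) DERIV_cong_ev[OF refl _ refl]) auto
qed

lemmas std_normal_cdf_deriv' [derivative_intros] =
  DERIV_chain2[OF std_normal_cdf_deriv]

lemma continuous_on_std_normal_cdf: "continuous_on UNIV \<Phi>"
  by (intro continuous_at_imp_continuous_on ballI DERIV_isCont[OF std_normal_cdf_deriv])

lemma std_normal_cdf_measurable [measurable]: "\<Phi> \<in> borel_measurable borel"
  by (intro borel_measurable_continuous_onI continuous_on_std_normal_cdf)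

lemma std_normal_density_deriv:
  "(\<phi> has_real_derivative - t * \<phi> t) (at t)"
proof -
  have "((\<lambda>t. (1 / sqrt (2 * pi)) * exp (- t\<^sup>2 / 2)) has_real_derivative
          - t * ((1 / sqrt (2 * pi)) * exp (- t\<^sup>2 / 2))) (at t)"
    by (auto intro!: derivative_eq_intros simp: field_simps)
  then show ?thesis
    unfolding std_normal_density_def .
qed

lemmas std_normal_density_deriv' [derivative_intros] =
  DERIV_chain2[OF std_normal_density_deriv]

text \<open>The density is even, so \<open>\<Phi> (- t) + \<Phi> t\<close> has derivative zero; its
  constant value is the limit 0 + 1 at infinity.\<close>

lemma std_normal_cdf_minus: "\<Phi> (- t) = 1 - \<Phi> t"
proof -
  have d: "((\<lambda>t. \<Phi> (- t) + \<Phi> t) has_real_derivative 0) (at x)" for x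
    by (auto intro!: derivative_eq_intros simp: std_normal_density_def)
  have const: "\<Phi> (- x) + \<Phi> x = \<Phi> (- t) + \<Phi> t" for x
    using DERIV_isconst_all[of "\<lambda>t. \<Phi> (- t) + \<Phi> t" x t] d by auto
  have "((\<lambda>x. \<Phi> (- x) + \<Phi> x) \<longlongrightarrow> 0 + 1) at_top"
    by (intro tendsto_add std_normal_cdf_at_top
        filterlim_compose[OF std_normal_cdf_at_bot filterlim_uminus_at_bot_at_top])
  then have "((\<lambda>x::real. \<Phi> (- t) + \<Phi> t) \<longlongrightarrow> 1) at_top"
    by (subst (asm) const) simp
  then have "\<Phi> (- t) + \<Phi> t = 1"
    by (simp add: tendsto_const_iff)
  then show ?thesis by simp
qed

lemma std_normal_cdf_zero: "\<Phi> 0 = 1 / 2"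
  using std_normal_cdf_minus[of 0] by simp

text \<open>\<open>inv\<close> returns some preimage whenever one exists, so what matters is that
  \<open>u\<close> lies in the range of \<Phi>; the limits at both ends and the intermediate value
  theorem provide this.\<close>

lemma std_normal_cdf_quantile:
  assumes "0 < u" "u < 1"
  shows "\<Phi> (std_normal_quantile u) = u"
proof -
  have "\<forall>\<^sub>F x in at_bot. \<Phi> x < u"
    using order_tendstoD(2)[OF std_normal_cdf_at_bot assms(1)] .
  then obtain a where a: "\<Phi> a < u"
    using eventually_happens by fastforce
  have "\<forall>\<^sub>F x in at_top. \<Phi> x > u"
    using order_tendstoD(1)[OF std_normal_cdf_at_top assms(2)] .
  then obtain b where b: "\<Phi> b > u"
    using eventually_happens by fastforce
  have "a \<le> b"
    using a b std_normal_cdf_mono[of b a] by linarith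
  then obtain x where "\<Phi> x = u"
    using IVT'[of \<Phi> a u b] a b continuous_on_subset[OF continuous_on_std_normal_cdf] by auto
  then show ?thesis
    unfolding std_normal_quantile_def std_normal_cdf_def[symmetric] by (intro f_inv_into_f) auto
qed

lemma std_normal_cdf_less_imp: "\<Phi> a < \<Phi> b \<Longrightarrow> a < b"
  using std_normal_cdf_mono[of b a] by linarith

text \<open>The shifted tail is compared by monotonicity: both sides vanish at infinity.\<close>

lemma std_normal_tail_shift:
  assumes "x \<ge> 0"
  shows "1 - \<Phi> (t + x) \<le> exp (- x * t - x\<^sup>2 / 2) * (1 - \<Phi> t)"
proof -
  define D where "D = (\<lambda>t. exp (- x * t - x\<^sup>2 / 2) * (1 - \<Phi> t) - (1 - \<Phi> (t + x)))"
  have shift: "\<phi> (s + x) = exp (- x * s - x\<^sup>2 / 2) * \<phi> s" for s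
    unfolding std_normal_density_def
    by (simp add: exp_add[symmetric] power2_eq_square field_simps)
  \<comment> \<open>By \<open>shift\<close> the two density terms of the derivative cancel, and only
    the derivative of the exponential factor is left.\<close>
  have D': "(D has_real_derivative - x * exp (- x * s - x\<^sup>2 / 2) * (1 - \<Phi> s)) (at s)" for s
    unfolding D_def
    by (auto intro!: derivative_eq_intros simp: shift algebra_simps)
  have antimono: "D s \<le> D t" if "t \<le> s" for s
    using that
  proof (rule DERIV_nonpos_imp_nonincreasing)
    fix y
    have "- x * exp (- x * y - x\<^sup>2 / 2) * (1 - \<Phi> y) \<le> 0"
      using assms std_normal_cdf_le_1[of y]
      by (intro mult_nonpos_nonneg) (auto simp: mult_nonneg_nonneg)
    then show "\<exists>z. (D has_real_derivative z) (at y) \<and> z \<le> 0"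
      using D' by blast
  qed
  have lim: "((\<lambda>s. 1 - \<Phi> s) \<longlongrightarrow> 0) at_top"
    using tendsto_diff[OF tendsto_const std_normal_cdf_at_top, of 1] by simp
  have "(D \<longlongrightarrow> 0 - 0) at_top"
    unfolding D_def
  proof (rule tendsto_diff)
    show "((\<lambda>s. exp (- x * s - x\<^sup>2 / 2) * (1 - \<Phi> s)) \<longlongrightarrow> 0) at_top"
    proof (rule tendsto_sandwich[OF _ _ tendsto_const lim])
      show "\<forall>\<^sub>F s in at_top. 0 \<le> exp (- x * s - x\<^sup>2 / 2) * (1 - \<Phi> s)"
        by (auto intro!: always_eventually)
      show "\<forall>\<^sub>F s in at_top. exp (- x * s - x\<^sup>2 / 2) * (1 - \<Phi> s) \<le> 1 - \<Phi> s"
        using eventually_ge_at_top[of 0]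
      proof eventually_elim
        case (elim s)
        have "- x * s - x\<^sup>2 / 2 \<le> 0"
          using mult_nonneg_nonneg[OF assms elim] zero_le_power2[of x] by (simp only: mult_minus_left)
        then show ?case
          using std_normal_cdf_le_1[of s] by (intro mult_left_le_one_le) auto
      qed
    qed
    show "((\<lambda>s. 1 - \<Phi> (s + x)) \<longlongrightarrow> 0) at_top"
      by (rule filterlim_compose[OF lim]) (subst add.commute, rule filterlim_tendsto_add_at_top[OF tendsto_const filterlim_ident])
  qed
  then have "0 - 0 \<le> D t"
    by (rule tendsto_upperbound) (auto intro: eventually_mono[OF eventually_ge_at_top[of t]] antimono)
  then show ?thesis
    by (simp add: D_def)
qed

lemma std_normal_tail_le:
  assumes "t \<ge> 0"
  shows "1 - \<Phi> t \<le> exp (- t\<^sup>2 / 2) / 2"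
  using std_normal_tail_shift[OF assms, of 0] by (simp add: std_normal_cdf_zero)

lemma std_normal_density_antimono:
  assumes "0 \<le> s" "s \<le> t"
  shows "\<phi> t \<le> \<phi> s"
  using assms unfolding std_normal_density_def
  by (intro mult_left_mono) (auto intro: power_mono)

text \<open>Only the mass of the interval from t to t + 1 / t is kept. There the squared argument
  exceeds t^2 by at most 4, so the density falls by at most the factor exp (- 2) >= 1/9; with 1 /
  sqrt (2 * pi) >= 1/3 this gives the constant 27. The bound later converts Chernoff-type errors
  into errors relative to the Gaussian tail.\<close>

lemma std_normal_tail_ge:
  assumes "t \<ge> 1"
  shows "1 - \<Phi> t \<ge> exp (- t\<^sup>2 / 2) / (27 * t)"
proof -
  obtain z where z: "t < z" "z < t + 1 / t" "\<Phi> (t + 1 / t) - \<Phi> t = (t + 1 / t - t) * \<phi> z"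
    using MVT2[of t "t + 1 / t" \<Phi> \<phi>] assms std_normal_cdf_deriv by auto
  have "sqrt (2 * pi) \<le> sqrt (9::real)"
    using pi_less_4 by (intro real_sqrt_le_mono) simp
  then have s: "1 / 3 \<le> 1 / sqrt (2 * pi)" 
    by (simp add: field_simps)
  have "exp (2::real) = exp 1 * exp 1"
    by (simp add: exp_add[symmetric])
  also have "\<dots> \<le> 3 * 3"
    using e_less_272 by (intro mult_mono) auto
  finally have "inverse 9 \<le> inverse (exp (2::real))"
    by (intro le_imp_inverse_le) auto
  then have e: "1 / 9 \<le> exp (- 2 :: real)"
    by (simp add: exp_minus)
  have "(t + 1 / t)\<^sup>2 \<le> t\<^sup>2 + 4"
  proof -
    have "0 \<le> 1 / t" "1 / t \<le> 1" using assms by auto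
    then have "(1 / t)\<^sup>2 \<le> 1" by (intro power_le_one)
    moreover have "(t + 1 / t)\<^sup>2 = t\<^sup>2 + 2 + (1 / t)\<^sup>2"
      using assms by (simp add: power2_sum)
    ultimately show ?thesis by linarith
  qed
  then have "exp (- t\<^sup>2 / 2 + - 2) \<le> exp (- (t + 1 / t)\<^sup>2 / 2)"
    by simp
  then have *: "exp (- t\<^sup>2 / 2) * exp (- 2) \<le> exp (- (t + 1 / t)\<^sup>2 / 2)"
    by (simp only: exp_add)
  have "exp (- t\<^sup>2 / 2) / (27 * t) = 1 / t * (1 / 3 * (exp (- t\<^sup>2 / 2) * (1 / 9)))"
    by simp
  also have "\<dots> \<le> 1 / t * (1 / sqrt (2 * pi) * (exp (- t\<^sup>2 / 2) * exp (- 2)))"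
    using assms s e by (intro mult_left_mono mult_mono) auto
  also have "\<dots> \<le> 1 / t * \<phi> (t + 1 / t)"
    unfolding std_normal_density_def using assms * by (intro mult_left_mono) auto
  also have "\<dots> \<le> 1 / t * \<phi> z"
    using assms z by (intro mult_left_mono std_normal_density_antimono) auto
  also have "\<dots> = \<Phi> (t + 1 / t) - \<Phi> t"
    using z(3) by simp
  also have "\<dots> \<le> 1 - \<Phi> t"
    using std_normal_cdf_le_1[of "t + 1 / t"] by simp
  finally show ?thesis .
qed

lemma std_normal_cdf_diff_le:
  assumes "0 \<le> s" "s \<le> t"
  shows "\<Phi> t - \<Phi> s \<le> (t - s) * \<phi> s"
proof (cases "s = t")
  case False
  then obtain z where "s < z" "z < t" "\<Phi> t - \<Phi> s = (t - s) * \<phi> z"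
    using MVT2[of s t \<Phi> \<phi>] assms std_normal_cdf_deriv by auto
  then show ?thesis
    using std_normal_density_antimono[of s z] assms by (auto intro!: mult_left_mono)
qed simp

subsection \<open>The heat kernel\<close>

text \<open>Completing the square: the heat kernel at time \<open>v\<close> is dominated by the exponential weight
  \<open>exp (u y + u\<^sup>2 v / 2)\<close>, which is what the sum of the remaining Gaussian increments
  would contribute to a Chernoff bound.\<close>

lemma cubic_gauss_le:
  fixes z u v :: real
  assumes v: "0 < v" "v \<le> 2" and u: "1 \<le> u"
  shows "(1 + \<bar>z\<bar>) ^ 3 * \<phi> z \<le> 27000 * u ^ 3 * exp (u * (z * sqrt v) + u\<^sup>2 * v / 2)"
proof -
  \<comment> \<open>With w = z + a the square is completed: - z^2 / 2 = - w^2 / 2 + (a * z + a^2 /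
    2), and the last bracket is the exponent of the weight.\<close>
  define a where "a = u * sqrt v"
  define w where "w = z + a"
  have "sqrt v \<le> sqrt (4::real)"
    using v by (intro real_sqrt_le_mono) simp
  then have a: "0 \<le> a" "a \<le> 2 * u"
    using u v by (auto simp: a_def mult.commute)
  have "sqrt (1::real) \<le> sqrt (2 * pi)"
    using pi_gt3 by (intro real_sqrt_le_mono) simp
  then have p: "\<phi> z \<le> exp (- z\<^sup>2 / 2)"
    unfolding std_normal_density_def by (simp add: field_simps mult_left_le)
  have sq: "- z\<^sup>2 / 2 = - w\<^sup>2 / 2 + (a * z + a\<^sup>2 / 2)"
    by (simp add: w_def power2_sum field_simps)
  have a2: "a * z + a\<^sup>2 / 2 = u * (z * sqrt v) + u\<^sup>2 * v / 2"
    using v by (simp add: a_def power_mult_distrib)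
  have "1 + \<bar>z\<bar> \<le> (1 + \<bar>w\<bar>) * (3 * u)"
  proof -
    have "1 + \<bar>z\<bar> \<le> 1 + \<bar>w\<bar> + 2 * u"
      using a by (simp add: w_def)
    also have "\<dots> \<le> (1 + \<bar>w\<bar>) * u + (1 + \<bar>w\<bar>) * (2 * u)"
      using u by (intro add_mono) (auto simp: mult_le_cancel_left1)
    finally show ?thesis by (simp add: algebra_simps)
  qed
  then have z3: "(1 + \<bar>z\<bar>) ^ 3 \<le> (1 + \<bar>w\<bar>) ^ 3 * (27 * u ^ 3)"
    using power_mono[of "1 + \<bar>z\<bar>" "(1 + \<bar>w\<bar>) * (3 * u)" 3] by (simp add: power_mult_distrib)
  \<comment> \<open>The leftover Gaussian in w absorbs the cubic factor: (1 + |w|)^3 <= 27 * exp (1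
    + |w|), then 1 + |w| <= 2 + w^2 / 2 and exp 2 <= 9, so 243 = 27 * 9.\<close>
  have "((1 + \<bar>w\<bar>) / 3) ^ 3 \<le> exp ((1 + \<bar>w\<bar>) / 3) ^ 3"
    by (intro power_mono order_trans[OF _ exp_ge_add_one_self]) auto
  also have "\<dots> = exp (1 + \<bar>w\<bar>)"
    by (simp add: exp_of_nat_mult[symmetric])
  also have "\<dots> \<le> exp (2 + w\<^sup>2 / 2)"
    using zero_le_power2[of "\<bar>w\<bar> - 1"] by (simp add: power2_diff)
  also have "\<dots> = exp 2 * exp (w\<^sup>2 / 2)"
    by (rule exp_add)
  also have "\<dots> \<le> 9 * exp (w\<^sup>2 / 2)"
  proof -
    have "exp (2::real) = exp 1 * exp 1"
      by (simp add: exp_add[symmetric])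
    also have "\<dots> \<le> 3 * 3"
      using e_less_272 by (intro mult_mono) auto
    finally show ?thesis by simp
  qed
  finally have "(1 + \<bar>w\<bar>) ^ 3 \<le> 243 * exp (w\<^sup>2 / 2)"
    by (simp add: power_divide)
  then have w3: "(1 + \<bar>w\<bar>) ^ 3 * exp (- w\<^sup>2 / 2) \<le> 243"
    by (simp add: exp_minus field_simps)
  have "(1 + \<bar>z\<bar>) ^ 3 * \<phi> z \<le> ((1 + \<bar>w\<bar>) ^ 3 * (27 * u ^ 3)) * exp (- z\<^sup>2 / 2)"
    using z3 p u by (intro mult_mono) auto
  also have "\<dots> = ((1 + \<bar>w\<bar>) ^ 3 * exp (- w\<^sup>2 / 2)) * (27 * u ^ 3) * exp (a * z + a\<^sup>2 / 2)"
    unfolding sq exp_add by simp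
  also have "\<dots> \<le> 243 * (27 * u ^ 3) * exp (a * z + a\<^sup>2 / 2)"
    using w3 u by (intro mult_right_mono) auto
  also have "\<dots> \<le> 27000 * u ^ 3 * exp (a * z + a\<^sup>2 / 2)"
    using u by (intro mult_right_mono) auto
  finally show ?thesis
    unfolding a2 .
qed

text \<open>The indicator of the half-line from 0 upwards, smoothed by a centred Gaussian of
  variance \<open>v\<close>: a solution of the heat equation with time \<open>v\<close>.
  \<open>heat1\<close> to \<open>heat4\<close> are its first four derivatives in \<open>y\<close>,
  Hermite polynomials times the density.\<close>

definition heat :: "real \<Rightarrow> real \<Rightarrow> real" where
  "heat v y = \<Phi> (y / sqrt v)"

definition heat1 :: "real \<Rightarrow> real \<Rightarrow> real" where
  "heat1 v y = \<phi> (y / sqrt v) / sqrt v"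

definition heat2 :: "real \<Rightarrow> real \<Rightarrow> real" where
  "heat2 v y = - (y / sqrt v) * \<phi> (y / sqrt v) / v"

definition heat3 :: "real \<Rightarrow> real \<Rightarrow> real" where
  "heat3 v y = ((y / sqrt v)\<^sup>2 - 1) * \<phi> (y / sqrt v) / (v * sqrt v)"

definition heat4 :: "real \<Rightarrow> real \<Rightarrow> real" where
  "heat4 v y = (3 * (y / sqrt v) - (y / sqrt v) ^ 3) * \<phi> (y / sqrt v) / v\<^sup>2"

lemma heat_bounds: "0 \<le> heat v y" "heat v y \<le> 1"
  by (auto simp: heat_def)

lemma heat_deriv:
  assumes "v > 0"
  shows "(heat v has_real_derivative heat1 v y) (at y)"
    and "(heat1 v has_real_derivative heat2 v y) (at y)"
    and "(heat2 v has_real_derivative heat3 v y) (at y)"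
proof -
  obtain s where s: "s > 0" "v = s\<^sup>2"
    using assms by (metis real_sqrt_gt_zero real_sqrt_pow2 less_imp_le)
  show "(heat v has_real_derivative heat1 v y) (at y)"
    and "(heat1 v has_real_derivative heat2 v y) (at y)"
    and "(heat2 v has_real_derivative heat3 v y) (at y)"
    unfolding heat_def heat1_def heat2_def heat3_def using s
    by (auto intro!: derivative_eq_intros simp: field_simps power2_eq_square)
qed

text \<open>Heat equation: a derivative in time is half of two derivatives in space. Using it twice
  is why the fourth space derivative governs the time remainder below.\<close>

lemma heat_time_deriv:
  assumes "v > 0"
  shows "((\<lambda>v. heat v y) has_real_derivative heat2 v y / 2) (at v)"
    and "((\<lambda>v. heat2 v y / 2) has_real_derivative heat4 v y / 4) (at v)"
proof -
  obtain s where s: "s > 0" "v = s\<^sup>2"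
    using assms by (metis real_sqrt_gt_zero real_sqrt_pow2 less_imp_le)
  show "((\<lambda>v. heat v y) has_real_derivative heat2 v y / 2) (at v)"
    unfolding heat_def heat2_def using assms s
    by (auto intro!: derivative_eq_intros simp: field_simps power2_eq_square)
  show "((\<lambda>v. heat2 v y / 2) has_real_derivative heat4 v y / 4) (at v)"
    unfolding heat2_def heat4_def using assms s
    by (auto intro!: derivative_eq_intros simp: field_simps power2_eq_square power3_eq_cube)
qed

text \<open>The common shape of the four derivatives: a polynomial \<open>P\<close> of degree at
  most 3 in y / sqrt v, times the density, over a power \<open>D\<close> of sqrt v up to the fourth.
  Since sqrt v >= d and d <= 1, d^4 is below each of these powers; 81000 is 3 times the constant of
  \<open>cubic_gauss_le\<close>.\<close>

lemma heat_bound_aux: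
  assumes d: "0 < d" "d \<le> 1" "d\<^sup>2 \<le> v" and v: "v \<le> 2" and u: "1 \<le> u"
    and P: "\<bar>P\<bar> \<le> 3 * (1 + \<bar>y / sqrt v\<bar>) ^ 3" and D: "d ^ 4 \<le> D"
  shows "\<bar>P * \<phi> (y / sqrt v) / D\<bar> \<le> 81000 * u ^ 3 / d ^ 4 * exp (u * y + u\<^sup>2 * v / 2)"
proof -
  have v0: "v > 0"
    using d by (smt (verit) zero_less_power)
  have d4: "0 < d ^ 4" using d by simp
  have "\<bar>P * \<phi> (y / sqrt v) / D\<bar> = (\<bar>P\<bar> * \<phi> (y / sqrt v)) / D"
    using order_less_le_trans[OF d4 D] by (simp add: abs_mult)
  also have "\<dots> \<le> (3 * (1 + \<bar>y / sqrt v\<bar>) ^ 3 * \<phi> (y / sqrt v)) / d ^ 4"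
    using P D d4 by (intro frac_le mult_right_mono mult_nonneg_nonneg) auto
  also have "\<dots> \<le> (3 * (27000 * u ^ 3 * exp (u * (y / sqrt v * sqrt v) + u\<^sup>2 * v / 2))) / d ^ 4"
    unfolding mult.assoc[of 3]
    using cubic_gauss_le[OF v0 v u, of "y / sqrt v"] d4
    by (intro divide_right_mono mult_left_mono) auto
  finally show ?thesis
    using v0 by simp
qed

lemma heat_weight_bounds:
  assumes d: "0 < d" "d \<le> 1" "d\<^sup>2 \<le> v" and v: "v \<le> 2" and u: "1 \<le> u"
  shows "\<bar>heat1 v y\<bar> \<le> 81000 * u ^ 3 / d ^ 4 * exp (u * y + u\<^sup>2 * v / 2)" (is "_ \<le> ?R")
    and "\<bar>heat2 v y\<bar> \<le> 81000 * u ^ 3 / d ^ 4 * exp (u * y + u\<^sup>2 * v / 2)"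
    and "\<bar>heat3 v y\<bar> \<le> 81000 * u ^ 3 / d ^ 4 * exp (u * y + u\<^sup>2 * v / 2)"
    and "\<bar>heat4 v y\<bar> \<le> 81000 * u ^ 3 / d ^ 4 * exp (u * y + u\<^sup>2 * v / 2)"
proof -
  have ds: "d \<le> sqrt v"
    using d by (simp add: real_le_rsqrt)
  have pw: "d ^ 4 \<le> d ^ k" if "k \<le> 4" for k
    using d that by (intro power_decreasing) auto
  define z where "z = \<bar>y / sqrt v\<bar>"
  have z: "0 \<le> z" by (simp add: z_def)
  have e: "(1 + z) ^ 3 = 1 + 3 * z + 3 * z\<^sup>2 + z ^ 3"
    by (simp add: power3_eq_cube power2_eq_square algebra_simps)
  have 1: "d ^ 4 \<le> sqrt v" using pw[of 1] ds by simp
  have 2: "d ^ 4 \<le> v" using pw[of 2] d by simp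
  have 3: "d ^ 4 \<le> v * sqrt v"
  proof -
    have "d ^ 4 \<le> d\<^sup>2 * d" using pw[of 3] by (simp add: power3_eq_cube power2_eq_square)
    also have "\<dots> \<le> v * sqrt v" using d ds order_trans[OF zero_le_power2 d(3)] by (intro mult_mono) auto
    finally show ?thesis .
  qed
  have 4: "d ^ 4 \<le> v\<^sup>2"
    using power_mono[OF d(3), of 2] by simp
  have b: "\<bar>1::real\<bar> \<le> 3 * (1 + \<bar>y / sqrt v\<bar>) ^ 3"
    "\<bar>- (y / sqrt v)\<bar> \<le> 3 * (1 + \<bar>y / sqrt v\<bar>) ^ 3"
    "\<bar>(y / sqrt v)\<^sup>2 - 1\<bar> \<le> 3 * (1 + \<bar>y / sqrt v\<bar>) ^ 3"
    "\<bar>3 * (y / sqrt v) - (y / sqrt v) ^ 3\<bar> \<le> 3 * (1 + \<bar>y / sqrt v\<bar>) ^ 3"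
  proof -
    have n: "0 \<le> z\<^sup>2" "0 \<le> z ^ 3" using z by auto
    show "\<bar>1::real\<bar> \<le> 3 * (1 + \<bar>y / sqrt v\<bar>) ^ 3"
      unfolding z_def[symmetric] e using z n by simp
    show "\<bar>- (y / sqrt v)\<bar> \<le> 3 * (1 + \<bar>y / sqrt v\<bar>) ^ 3"
      unfolding abs_minus_cancel z_def[symmetric] e using z n by simp
    have "\<bar>(y / sqrt v)\<^sup>2 - 1\<bar> \<le> \<bar>y / sqrt v\<bar>\<^sup>2 + 1"
      using abs_triangle_ineq4[of "(y / sqrt v)\<^sup>2" 1] by (simp only: power_abs[symmetric] abs_power2 abs_one power2_abs)
    also have "\<dots> \<le> 3 * (1 + \<bar>y / sqrt v\<bar>) ^ 3"
      unfolding z_def[symmetric] e using z n by simp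
    finally show "\<bar>(y / sqrt v)\<^sup>2 - 1\<bar> \<le> 3 * (1 + \<bar>y / sqrt v\<bar>) ^ 3" .
    have "\<bar>3 * (y / sqrt v) - (y / sqrt v) ^ 3\<bar> \<le> \<bar>3 * (y / sqrt v)\<bar> + \<bar>(y / sqrt v) ^ 3\<bar>"
      by (rule abs_triangle_ineq4)
    also have "\<dots> = 3 * \<bar>y / sqrt v\<bar> + \<bar>y / sqrt v\<bar> ^ 3"
      by (simp only: power_abs abs_mult abs_numeral)
    also have "\<dots> \<le> 3 * (1 + \<bar>y / sqrt v\<bar>) ^ 3"
      unfolding z_def[symmetric] e using z n by simp
    finally show "\<bar>3 * (y / sqrt v) - (y / sqrt v) ^ 3\<bar> \<le> 3 * (1 + \<bar>y / sqrt v\<bar>) ^ 3" .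
  qed
  show "\<bar>heat1 v y\<bar> \<le> ?R"
    unfolding heat1_def using heat_bound_aux[OF d v u b(1) 1] by (simp only: mult_1)
  show "\<bar>heat2 v y\<bar> \<le> ?R"
    unfolding heat2_def by (rule heat_bound_aux[OF d v u b(2) 2])
  show "\<bar>heat3 v y\<bar> \<le> ?R"
    unfolding heat3_def by (rule heat_bound_aux[OF d v u b(3) 3])
  show "\<bar>heat4 v y\<bar> \<le> ?R"
    unfolding heat4_def by (rule heat_bound_aux[OF d v u b(4) 4])
qed

subsection \<open>Lindeberg replacement for small summands\<close>

lemma exp_taylor2_le:
  fixes x :: real
  assumes "\<bar>x\<bar> \<le> 1"
  shows "exp x \<le> 1 + x + x\<^sup>2 / 2 + \<bar>x\<bar> ^ 3"
proof -
  obtain t where t: "\<bar>t\<bar> \<le> \<bar>x\<bar>" "exp x = (\<Sum>m<3. x ^ m / fact m) + exp t / fact 3 * x ^ 3"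
    using Maclaurin_exp_le[of x 3] by blast
  have "exp t \<le> exp 1"
    using t assms by simp
  then have e: "exp t \<le> 3"
    using e_less_272 by linarith
  have "exp t / fact 3 * x ^ 3 \<le> \<bar>exp t / fact 3 * x ^ 3\<bar>"
    by (rule abs_ge_self)
  also have "\<dots> = exp t / 6 * \<bar>x\<bar> ^ 3"
    by (simp add: abs_mult power_abs fact_numeral)
  also have "\<dots> \<le> 1 * \<bar>x\<bar> ^ 3"
    using e by (intro mult_right_mono) auto
  finally show ?thesis
    unfolding t(2) by (simp add: eval_nat_numeral)
qed

text \<open>Third order Taylor expansion. The intermediate point is off by at most b, so by u * b <=
  1 the weight there is at most exp 1 <= 3 times the weight at y, and 3 / 3! <= 1. One factor of
  |X|^3 is replaced by b, so that second moments suffice afterwards.\<close>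

lemma heat_taylor_space:
  assumes d: "0 < d" "d \<le> 1" "d\<^sup>2 \<le> v" and v: "v \<le> 2" and u: "1 \<le> u"
    and X: "\<bar>X\<bar> \<le> b" and ub: "u * b \<le> 1"
  shows "heat v (y + X) \<le> heat v y + X * heat1 v y + X\<^sup>2 / 2 * heat2 v y
    + b * X\<^sup>2 * (81000 * u ^ 3 / d ^ 4 * exp (u * y + u\<^sup>2 * v / 2))"
proof -
  define R where "R = 81000 * u ^ 3 / d ^ 4 * exp (u * y + u\<^sup>2 * v / 2)"
  have R: "0 \<le> R" using d u by (simp add: R_def)
  have v0: "v > 0"
    using d by (smt (verit) zero_less_power)
  define diff where "diff = (\<lambda>m. [\<lambda>x. heat v (y + x), \<lambda>x. heat1 v (y + x), \<lambda>x. heat2 v (y + x),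
      \<lambda>x. heat3 v (y + x)] ! m)"
  have "\<exists>t. \<bar>t\<bar> \<le> \<bar>X\<bar> \<and> heat v (y + X) = (\<Sum>m<3. diff m 0 / fact m * X ^ m) + diff 3 t / fact 3 * X ^ 3"
  proof (rule Maclaurin_bi_le[where f="\<lambda>x. heat v (y + x)"])
    show "\<forall>m t. m < 3 \<and> \<bar>t\<bar> \<le> \<bar>X\<bar> \<longrightarrow> (diff m has_real_derivative diff (Suc m) t) (at t)"
    proof (intro allI impI)
      fix m :: nat and t assume mt: "m < 3 \<and> \<bar>t\<bar> \<le> \<bar>X\<bar>"
      have g: "((\<lambda>x. y + x) has_real_derivative 1) (at t)"
        by (auto intro!: derivative_eq_intros)
      from mt consider "m = 0" | "m = 1" | "m = 2" by linarith
      then show "(diff m has_real_derivative diff (Suc m) t) (at t)"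
        using DERIV_chain2[OF heat_deriv(1)[OF v0, of "y + t"] g]
              DERIV_chain2[OF heat_deriv(2)[OF v0, of "y + t"] g]
              DERIV_chain2[OF heat_deriv(3)[OF v0, of "y + t"] g]
        by cases (auto simp: diff_def eval_nat_numeral)
    qed
  qed (simp add: diff_def)
  then obtain t where t: "\<bar>t\<bar> \<le> \<bar>X\<bar>"
    "heat v (y + X) = heat v y + heat1 v y * X + heat2 v y / 2 * X\<^sup>2 + heat3 v (y + t) / 6 * X ^ 3"
    by (auto simp: diff_def eval_nat_numeral)
  have "u * t \<le> u * b"
    using t X u by (intro mult_left_mono) auto
  then have "exp (u * t) \<le> exp 1"
    using ub by simp
  then have e: "exp (u * t) \<le> 3"
    using e_less_272 by linarith
  have "\<bar>heat3 v (y + t)\<bar> \<le> 81000 * u ^ 3 / d ^ 4 * exp (u * (y + t) + u\<^sup>2 * v / 2)"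
    by (rule heat_weight_bounds(3)[OF d v u])
  also have "\<dots> = R * exp (u * t)"
    by (simp add: R_def exp_add[symmetric] algebra_simps)
  also have "\<dots> \<le> R * 3"
    using e R by (intro mult_left_mono)
  finally have h3: "\<bar>heat3 v (y + t)\<bar> \<le> 3 * R" by simp
  have "heat3 v (y + t) / 6 * X ^ 3 \<le> \<bar>heat3 v (y + t) / 6 * X ^ 3\<bar>"
    by (rule abs_ge_self)
  also have "\<dots> = \<bar>heat3 v (y + t)\<bar> / 6 * (\<bar>X\<bar> * X\<^sup>2)"
    by (simp add: abs_mult power3_eq_cube power2_eq_square)
  also have "\<dots> \<le> R * (b * X\<^sup>2)"
    using h3 X R by (intro mult_mono mult_right_mono) auto
  finally show ?thesis
    unfolding t(2) R_def[symmetric] by (simp add: mult.commute mult.left_commute)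
qed

text \<open>Second order expansion in time. It trades the half second derivative, which the variance
  of a summand produces, for an advance of the clock by \<open>s\<close>. The weight at the
  intermediate time is increased to the one at v + s. The case s = 0 is separate because the
  expansion needs a positive increment.\<close>

lemma heat_taylor_time:
  assumes d: "0 < d" "d \<le> 1" "d\<^sup>2 \<le> v" and s: "0 \<le> s" "v + s \<le> 2" and u: "1 \<le> u"
  shows "heat v y + s / 2 * heat2 v y \<le> heat (v + s) y
    + s\<^sup>2 * (81000 * u ^ 3 / d ^ 4 * exp (u * y + u\<^sup>2 * (v + s) / 2))"
proof (cases "s = 0")
  case False
  then have s0: "s > 0" using s by simp
  define R where "R = 81000 * u ^ 3 / d ^ 4 * exp (u * y + u\<^sup>2 * (v + s) / 2)"
  have R: "0 \<le> R" using d u by (simp add: R_def)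
  have v0: "v > 0"
    using d by (smt (verit) zero_less_power)
  define diff where "diff = (\<lambda>m. [\<lambda>x. heat (v + x) y, \<lambda>x. heat2 (v + x) y / 2,
     \<lambda>x. heat4 (v + x) y / 4] ! m)"
  have "\<exists>t>0. t < s \<and> heat (v + s) y = (\<Sum>m<2. diff m 0 / fact m * s ^ m) + diff 2 t / fact 2 * s ^ 2"
  proof (rule Maclaurin[where f="\<lambda>x. heat (v + x) y"])
    show "\<forall>m t. m < 2 \<and> 0 \<le> t \<and> t \<le> s \<longrightarrow> (diff m has_real_derivative diff (Suc m) t) (at t)"
    proof (intro allI impI)
      fix m :: nat and t assume mt: "m < 2 \<and> 0 \<le> t \<and> t \<le> s"
      then have vt: "v + t > 0" using v0 by simp
      have g: "((\<lambda>x. v + x) has_real_derivative 1) (at t)"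
        by (auto intro!: derivative_eq_intros)
      from mt consider "m = 0" | "m = 1" by linarith
      then show "(diff m has_real_derivative diff (Suc m) t) (at t)"
        using DERIV_chain2[OF heat_time_deriv(1)[OF vt, of y] g]
              DERIV_chain2[OF heat_time_deriv(2)[OF vt, of y] g]
        by cases (auto simp: diff_def)
    qed
  qed (use s0 in \<open>auto simp: diff_def\<close>)
  then obtain t where t: "0 < t" "t < s"
    "heat (v + s) y = heat v y + heat2 v y / 2 * s + heat4 (v + t) y / 8 * s\<^sup>2"
    by (auto simp: diff_def eval_nat_numeral)
  have "\<bar>heat4 (v + t) y\<bar> \<le> 81000 * u ^ 3 / d ^ 4 * exp (u * y + u\<^sup>2 * (v + t) / 2)"
    using t s d by (intro heat_weight_bounds(4)[OF d(1,2) _ _ u]) auto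
  also have "\<dots> \<le> R"
    unfolding R_def using t d u
    by (intro mult_left_mono) (auto intro!: mult_left_mono divide_right_mono)
  finally have "heat4 (v + t) y \<ge> - 8 * R"
    using R by linarith
  then have "heat4 (v + t) y / 8 * s\<^sup>2 \<ge> - R * s\<^sup>2"
    by (intro mult_right_mono) auto
  then show ?thesis
    unfolding t(3) R_def[symmetric] by (simp add: mult.commute)
qed simp

text \<open>Truncated summands as functions of independent coordinates with law \<open>F\<close>. In
  the application \<open>s i\<close> is the variance before truncation and \<open>m i\<close> bounds
  the bias of the mean, so the clock advances by the untruncated variance while the truncation
  defects stay separate. \<open>u * b \<le> 1\<close> keeps the exponential weight stable under one
  summand; \<open>d\<close> is the initial smoothing width.\<close>

locale small_summands = prob_space F
  for F :: "real measure" +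
  fixes X :: "nat \<Rightarrow> real \<Rightarrow> real" and m s :: "nat \<Rightarrow> real" and b u d :: real
  assumes X_measurable [measurable]: "\<And>i. X i \<in> borel_measurable F"
    and X_le: "\<And>i z. \<bar>X i z\<bar> \<le> b"
    and b: "0 < b" "b \<le> 1" and u: "1 \<le> u" and ub: "u * b \<le> 1"
    and d: "0 < d" "d \<le> 1"
    and mean_le: "\<And>i. \<bar>expectation (X i)\<bar> \<le> m i"
    and second_moment_le: "\<And>i. expectation (\<lambda>z. (X i z)\<^sup>2) \<le> s i"
    and s_le: "\<And>i. s i \<le> b\<^sup>2"
begin

text \<open>The price of one replacement: bias of the mean, variance lost by truncation, and two
  Taylor remainders of at most b * s i each (in time, (s i)^2 <= b * s i because s i <= b^2 <=
  b).\<close>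

definition err :: "nat \<Rightarrow> real" where
  "err i = m i + (s i - expectation (\<lambda>z. (X i z)\<^sup>2)) + 2 * b * s i"

text \<open>The dominating function of \<open>heat_weight_bounds\<close>. It depends on y through
  \<open>exp (u * y)\<close>, so averaging it over coordinates only produces moment generating
  functions.\<close>

definition wt :: "real \<Rightarrow> real \<Rightarrow> real" where
  "wt v y = 81000 * u ^ 3 / d ^ 4 * exp (u * y + u\<^sup>2 * v / 2)"

lemma wt_nonneg: "0 \<le> wt v y"
  using u d by (simp add: wt_def)

lemma m_nonneg: "0 \<le> m i"
  using mean_le[of i] by linarith

lemma s_nonneg: "0 \<le> s i"
  using second_moment_le[of i] by (rule order_trans[rotated]) simp

lemma err_nonneg: "0 \<le> err i"
  using m_nonneg[of i] second_moment_le[of i] s_nonneg[of i] b by (simp add: err_def)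

lemma integrable_X: "integrable F (X i)"
  by (rule integrable_const_bound[of _ b]) (use X_le in auto)

lemma integrable_X2: "integrable F (\<lambda>z. (X i z)\<^sup>2)"
  by (rule integrable_const_bound[of _ "b\<^sup>2"])
    (use X_le b in \<open>auto simp: abs_le_square_iff[symmetric]\<close>)

lemma heat_measurable [measurable]: "heat v \<in> borel_measurable borel"
  unfolding heat_def by measurable

text \<open>One Lindeberg replacement. The space expansion is averaged over \<open>F\<close>, and
  its second order term with variance s i is recognised as the start of the time expansion. What is
  left is linear in the bias and in the variance defect, plus remainders; all weights are moved up
  to time v + s i.\<close>

lemma heat_step:
  assumes v: "d\<^sup>2 \<le> v" "v + s i \<le> 2"
  shows "expectation (\<lambda>z. heat v (y + X i z)) \<le> heat (v + s i) y + err i * wt (v + s i) y"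
proof -
  note sn = s_nonneg[of i]
  define e2 where "e2 = expectation (\<lambda>z. (X i z)\<^sup>2)"
  have e2: "0 \<le> e2" "e2 \<le> s i"
    using second_moment_le[of i] by (auto simp: e2_def)
  have v2: "v \<le> 2" using v sn by simp
  have wv: "wt v y \<le> wt (v + s i) y"
    unfolding wt_def using u d sn by (intro mult_left_mono) (auto intro!: mult_left_mono divide_right_mono)
  have "expectation (\<lambda>z. heat v (y + X i z)) \<le>
      expectation (\<lambda>z. heat v y + X i z * heat1 v y + (X i z)\<^sup>2 / 2 * heat2 v y + b * (X i z)\<^sup>2 * wt v y)"
  proof (rule integral_mono)
    show "integrable F (\<lambda>z. heat v (y + X i z))"
      by (rule integrable_const_bound[of _ 1]) (use heat_bounds in auto)
    show "integrable F (\<lambda>z. heat v y + X i z * heat1 v y + (X i z)\<^sup>2 / 2 * heat2 v y + b * (X i z)\<^sup>2 * wt v y)"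
      by (intro Bochner_Integration.integrable_add integrable_mult_left integrable_mult_right
          integrable_divide integrable_X integrable_X2 integrable_const)
  qed (use heat_taylor_space[OF d v(1) v2 u X_le ub] in \<open>simp add: wt_def\<close>)
  also have "\<dots> = heat v y + expectation (X i) * heat1 v y + e2 / 2 * heat2 v y + b * e2 * wt v y"
    using integrable_X[of i] integrable_X2[of i] by (simp add: e2_def prob_space)
  \<comment> \<open>The second moment is split as s i + (e2 - s i), the first part being what
    \<open>heat_taylor_time\<close> consumes.\<close>
  also have "\<dots> = (heat v y + s i / 2 * heat2 v y) + expectation (X i) * heat1 v y
      + (e2 - s i) / 2 * heat2 v y + b * e2 * wt v y"
    by (simp add: field_simps)
  also have "\<dots> \<le> (heat (v + s i) y + (s i)\<^sup>2 * wt (v + s i) y) + m i * wt (v + s i) y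
      + (s i - e2) * wt (v + s i) y + b * s i * wt (v + s i) y"
  proof -
    have h1: "heat v y + s i / 2 * heat2 v y \<le> heat (v + s i) y + (s i)\<^sup>2 * wt (v + s i) y"
      using heat_taylor_time[OF d v(1) sn v(2) u] by (simp add: wt_def)
    have "expectation (X i) * heat1 v y \<le> \<bar>expectation (X i)\<bar> * \<bar>heat1 v y\<bar>"
      by (simp add: abs_mult[symmetric])
    also have "\<dots> \<le> m i * wt v y"
      unfolding wt_def by (intro mult_mono mean_le heat_weight_bounds(1)[OF d v(1) v2 u] m_nonneg) auto
    also have "\<dots> \<le> m i * wt (v + s i) y"
      by (intro mult_left_mono wv m_nonneg)
    finally have h2: "expectation (X i) * heat1 v y \<le> m i * wt (v + s i) y" .
    have "(e2 - s i) / 2 * heat2 v y \<le> \<bar>(e2 - s i) / 2\<bar> * \<bar>heat2 v y\<bar>"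
      by (simp only: abs_mult[symmetric] abs_ge_self)
    also have "\<dots> \<le> (s i - e2) * wt v y"
      unfolding wt_def using e2 by (intro mult_mono heat_weight_bounds(2)[OF d v(1) v2 u]) auto
    also have "\<dots> \<le> (s i - e2) * wt (v + s i) y"
      using e2 by (intro mult_left_mono wv) auto
    finally have h3: "(e2 - s i) / 2 * heat2 v y \<le> (s i - e2) * wt (v + s i) y" .
    have h4: "b * e2 * wt v y \<le> b * s i * wt (v + s i) y"
      using b e2 wv wt_nonneg by (intro mult_mono) auto
    show ?thesis using h1 h2 h3 h4 by linarith
  qed
  also have "\<dots> = heat (v + s i) y + ((s i)\<^sup>2 + m i + (s i - e2) + b * s i) * wt (v + s i) y"
    by (simp add: algebra_simps)
  also have "\<dots> \<le> heat (v + s i) y + err i * wt (v + s i) y"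
  proof (intro add_left_mono mult_right_mono wt_nonneg)
    have "b\<^sup>2 \<le> b" using b by (simp add: power2_eq_square mult_left_le)
    then have "s i * s i \<le> b * s i"
      using s_le[of i] sn by (intro mult_right_mono) auto
    then show "(s i)\<^sup>2 + m i + (s i - e2) + b * s i \<le> err i"
      by (simp add: err_def e2_def power2_eq_square)
  qed
  finally show ?thesis .
qed

text \<open>Serves to average the weight over the remaining coordinates. Up to the bias and a cubic
  term the bound is the Gaussian one, which is exactly the growth of \<open>wt\<close> in
  time.\<close>

lemma mgf_le: "expectation (\<lambda>z. exp (u * X i z)) \<le> exp (u * m i + u\<^sup>2 * s i / 2 + u ^ 3 * b * s i)"
proof -
  define e2 where "e2 = expectation (\<lambda>z. (X i z)\<^sup>2)"
  have e2: "0 \<le> e2" "e2 \<le> s i"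
    using second_moment_le[of i] by (auto simp: e2_def)
  have uX: "\<bar>u * X i z\<bar> \<le> 1" for z
    using X_le[of i z] u ub by (simp add: abs_mult) (smt (verit) mult_left_mono)
  have pt: "exp (u * X i z) \<le> 1 + u * X i z + u\<^sup>2 / 2 * (X i z)\<^sup>2 + u ^ 3 * b * (X i z)\<^sup>2" for z
  proof -
    have "\<bar>u * X i z\<bar> ^ 3 = u ^ 3 * (\<bar>X i z\<bar> * (X i z)\<^sup>2)"
      using u by (simp add: abs_mult power_mult_distrib) (simp add: power3_eq_cube power2_eq_square)
    also have "\<dots> \<le> u ^ 3 * (b * (X i z)\<^sup>2)"
      using u X_le by (intro mult_left_mono mult_right_mono) auto
    finally show ?thesis
      using exp_taylor2_le[OF uX[of z]] by (simp add: power_mult_distrib)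
  qed
  have "expectation (\<lambda>z. exp (u * X i z)) \<le>
      expectation (\<lambda>z. 1 + u * X i z + u\<^sup>2 / 2 * (X i z)\<^sup>2 + u ^ 3 * b * (X i z)\<^sup>2)"
  proof (rule integral_mono[OF _ _ pt])
    show "integrable F (\<lambda>z. exp (u * X i z))"
    proof (rule integrable_const_bound[of _ "exp 1"])
      have "u * X i z \<le> 1" for z using uX[of z] by linarith
      then show "AE z in F. norm (exp (u * X i z)) \<le> exp 1" by simp
    qed simp
    show "integrable F (\<lambda>z. 1 + u * X i z + u\<^sup>2 / 2 * (X i z)\<^sup>2 + u ^ 3 * b * (X i z)\<^sup>2)"
      by (intro Bochner_Integration.integrable_add integrable_mult_right
          integrable_X integrable_X2 integrable_const)
  qed
  also have "\<dots> = 1 + u * expectation (X i) + u\<^sup>2 / 2 * e2 + u ^ 3 * b * e2"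
    using integrable_X[of i] integrable_X2[of i] by (simp add: e2_def prob_space)
  also have "\<dots> \<le> 1 + u * m i + u\<^sup>2 / 2 * s i + u ^ 3 * b * s i"
    using u b e2 mean_le[of i] by (intro add_mono mult_left_mono) auto
  also have "\<dots> \<le> exp (u * m i + u\<^sup>2 * s i / 2 + u ^ 3 * b * s i)"
    using exp_ge_add_one_self[of "u * m i + u\<^sup>2 * s i / 2 + u ^ 3 * b * s i"] by (simp add: add.assoc)
  finally show ?thesis .
qed

sublocale P: product_sigma_finite "\<lambda>_::nat. F"
  by unfold_locales

lemma prob_space_PiM_F: "prob_space (Pi\<^sub>M I (\<lambda>_. F))"
  by (intro prob_space_PiM prob_space_axioms)

lemma sum_measurable [measurable]:
  assumes "J \<subseteq> I"
  shows "(\<lambda>\<omega>. \<Sum>i\<in>J. X i (\<omega> i)) \<in> borel_measurable (Pi\<^sub>M I (\<lambda>_. F))"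
proof (rule borel_measurable_sum)
  fix i assume "i \<in> J"
  then show "(\<lambda>\<omega>. X i (\<omega> i)) \<in> borel_measurable (Pi\<^sub>M I (\<lambda>_. F))"
    using assms measurable_compose[of "\<lambda>\<omega>. \<omega> i", OF _ X_measurable]
    by (auto intro!: measurable_component_singleton)
qed

lemma sum_X_le: "\<bar>\<Sum>i\<in>I. X i (\<omega> i)\<bar> \<le> real (card I) * b"
  by (rule order_trans[OF sum_abs]) (rule sum_bounded_above[OF X_le])

lemma integrable_exp_sum:
  "integrable (Pi\<^sub>M I (\<lambda>_. F)) (\<lambda>\<omega>. exp (u * (y + (\<Sum>i\<in>I. X i (\<omega> i)))))"
proof -
  interpret Q: prob_space "Pi\<^sub>M I (\<lambda>_. F)" by (rule prob_space_PiM_F)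
  show ?thesis
  proof (rule Q.integrable_const_bound[of _ "exp (u * (y + real (card I) * b))"])
    have "u * (y + (\<Sum>i\<in>I. X i (\<omega> i))) \<le> u * (y + real (card I) * b)" for \<omega>
      using sum_X_le[of \<omega> I] u by (intro mult_left_mono) auto
    then show "AE \<omega> in Pi\<^sub>M I (\<lambda>_. F). norm (exp (u * (y + (\<Sum>i\<in>I. X i (\<omega> i))))) \<le> exp (u * (y + real (card I) * b))"
      by simp
  qed (use sum_measurable[of I I] in measurable)
qed

lemma exp_sum_le:
  assumes "finite I"
  shows "(\<integral>\<omega>. exp (u * (\<Sum>i\<in>I. X i (\<omega> i))) \<partial>Pi\<^sub>M I (\<lambda>_. F))
    \<le> exp (\<Sum>i\<in>I. u * m i + u\<^sup>2 * s i / 2 + u ^ 3 * b * s i)"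
proof -
  have "(\<integral>\<omega>. exp (u * (\<Sum>i\<in>I. X i (\<omega> i))) \<partial>Pi\<^sub>M I (\<lambda>_. F))
      = (\<integral>\<omega>. (\<Prod>i\<in>I. exp (u * X i (\<omega> i))) \<partial>Pi\<^sub>M I (\<lambda>_. F))"
    using assms by (simp add: sum_distrib_left exp_sum)
  also have "\<dots> = (\<Prod>i\<in>I. expectation (\<lambda>z. exp (u * X i z)))"
  proof (rule P.product_integral_prod[OF assms])
    fix i
    have "u * X i z \<le> u * b" for z using X_le[of i z] u by (intro mult_left_mono) auto
    then show "integrable F (\<lambda>z. exp (u * X i z))"
      by (intro integrable_const_bound[of _ "exp (u * b)"]) auto
  qed
  also have "\<dots> \<le> (\<Prod>i\<in>I. exp (u * m i + u\<^sup>2 * s i / 2 + u ^ 3 * b * s i))"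
    by (intro prod_mono conjI mgf_le Bochner_Integration.integral_nonneg) auto
  also have "\<dots> = exp (\<Sum>i\<in>I. u * m i + u\<^sup>2 * s i / 2 + u ^ 3 * b * s i)"
    using assms by (simp add: exp_sum)
  finally show ?thesis .
qed

text \<open>Induction with the start time \<open>v\<close> free: integrating out coordinate k
  advances the clock by s k, and the induction hypothesis continues from there. The error of step k
  is averaged over the remaining sum by \<open>exp_sum_le\<close>, whose Gaussian part carries the
  weight to the final time; hence each step is charged the same weight.\<close>

lemma heat_sum_le:
  assumes "finite I" "d\<^sup>2 \<le> v" "v + (\<Sum>i\<in>I. s i) \<le> 2"
  shows "(\<integral>\<omega>. heat v (y + (\<Sum>i\<in>I. X i (\<omega> i))) \<partial>Pi\<^sub>M I (\<lambda>_. F))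
    \<le> heat (v + (\<Sum>i\<in>I. s i)) y
      + (\<Sum>i\<in>I. err i) * wt (v + (\<Sum>i\<in>I. s i)) y * exp (\<Sum>i\<in>I. u * m i + u ^ 3 * b * s i)"
  using assms
proof (induction I arbitrary: v)
  case empty
  interpret Q: prob_space "Pi\<^sub>M {} (\<lambda>_::nat. F)" by (rule prob_space_PiM_F)
  show ?case by (simp add: Q.prob_space)
next
  case (insert k I)
  interpret Q: prob_space "Pi\<^sub>M I (\<lambda>_. F)" by (rule prob_space_PiM_F)
  interpret Q': prob_space "Pi\<^sub>M (insert k I) (\<lambda>_. F)" by (rule prob_space_PiM_F)
  let ?S = "\<lambda>\<omega>. \<Sum>i\<in>I. X i (\<omega> i)"
  let ?E = "\<Sum>i\<in>I. u * m i + u ^ 3 * b * s i"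
  let ?v = "v + s k + (\<Sum>i\<in>I. s i)"
  note [measurable] = sum_measurable[of I I] sum_measurable[of "insert k I" "insert k I"]
  have sI: "0 \<le> (\<Sum>i\<in>I. s i)"
    by (intro sum_nonneg s_nonneg)
  have vk: "v + s k \<le> 2" "d\<^sup>2 \<le> v + s k"
    using insert.prems insert.hyps sI s_nonneg[of k] by auto
  have i2: "integrable (Pi\<^sub>M I (\<lambda>_. F)) (\<lambda>\<omega>. heat (v + s k) (y + ?S \<omega>))"
    by (rule Q.integrable_const_bound[of _ 1]) (use heat_bounds in auto)
  have i3: "integrable (Pi\<^sub>M I (\<lambda>_. F)) (\<lambda>\<omega>. err k * wt (v + s k) (y + ?S \<omega>))"
    unfolding wt_def exp_add by (intro integrable_mult_left integrable_mult_right integrable_exp_sum)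
  have "(\<integral>\<omega>. heat v (y + (\<Sum>i\<in>insert k I. X i (\<omega> i))) \<partial>Pi\<^sub>M (insert k I) (\<lambda>_. F))
      = (\<integral>\<omega>. (\<integral>z. heat v (y + (\<Sum>i\<in>insert k I. X i (fun_upd \<omega> k z i))) \<partial>F) \<partial>Pi\<^sub>M I (\<lambda>_. F))"
  proof (rule P.product_integral_insert[OF insert.hyps(1,2)])
    show "integrable (Pi\<^sub>M (insert k I) (\<lambda>_. F)) (\<lambda>\<omega>. heat v (y + (\<Sum>i\<in>insert k I. X i (\<omega> i))))"
      by (rule Q'.integrable_const_bound[of _ 1]) (use heat_bounds in \<open>auto simp del: sum.insert\<close>)
  qed
  also have "\<dots> = (\<integral>\<omega>. (\<integral>z. heat v ((y + ?S \<omega>) + X k z) \<partial>F) \<partial>Pi\<^sub>M I (\<lambda>_. F))"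
  proof -
    have "(\<Sum>i\<in>insert k I. X i (fun_upd \<omega> k z i)) = X k z + ?S \<omega>" for \<omega> z
      using insert.hyps by (simp, intro sum.cong) auto
    then show ?thesis by (simp add: add_ac)
  qed
  also have "\<dots> \<le> (\<integral>\<omega>. heat (v + s k) (y + ?S \<omega>) + err k * wt (v + s k) (y + ?S \<omega>) \<partial>Pi\<^sub>M I (\<lambda>_. F))"
  proof (rule integral_mono)
    show "integrable (Pi\<^sub>M I (\<lambda>_. F)) (\<lambda>\<omega>. heat (v + s k) (y + ?S \<omega>) + err k * wt (v + s k) (y + ?S \<omega>))"
      by (intro Bochner_Integration.integrable_add i2 i3)
    show "integrable (Pi\<^sub>M I (\<lambda>_. F)) (\<lambda>\<omega>. (\<integral>z. heat v ((y + ?S \<omega>) + X k z) \<partial>F))"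
    proof (rule Q.integrable_const_bound[of _ 1])
      have "\<bar>expectation (\<lambda>z. heat v (x + X k z))\<bar> \<le> 1" for x
      proof -
        have "integrable F (\<lambda>z. heat v (x + X k z))"
          by (rule integrable_const_bound[of _ 1]) (use heat_bounds in auto)
        then have "expectation (\<lambda>z. heat v (x + X k z)) \<le> 1"
          by (rule integral_le_const) (use heat_bounds in auto)
        moreover have "0 \<le> expectation (\<lambda>z. heat v (x + X k z))"
          by (rule Bochner_Integration.integral_nonneg) (use heat_bounds in auto)
        ultimately show ?thesis by linarith
      qed
      then show "AE \<omega> in Pi\<^sub>M I (\<lambda>_. F). norm (\<integral>z. heat v ((y + ?S \<omega>) + X k z) \<partial>F) \<le> 1"
        by simp
    qed measurable
  qed (rule heat_step[OF insert.prems(1) vk(1)])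
  also have "\<dots> = (\<integral>\<omega>. heat (v + s k) (y + ?S \<omega>) \<partial>Pi\<^sub>M I (\<lambda>_. F))
      + err k * (\<integral>\<omega>. wt (v + s k) (y + ?S \<omega>) \<partial>Pi\<^sub>M I (\<lambda>_. F))"
    by (simp add: Bochner_Integration.integral_add[OF i2 i3])
  also have "\<dots> \<le> (heat ?v y + (\<Sum>i\<in>I. err i) * wt ?v y * exp ?E) + err k * (wt ?v y * exp ?E)"
  proof (intro add_mono mult_left_mono err_nonneg)
    show "(\<integral>\<omega>. heat (v + s k) (y + ?S \<omega>) \<partial>Pi\<^sub>M I (\<lambda>_. F))
      \<le> heat ?v y + (\<Sum>i\<in>I. err i) * wt ?v y * exp ?E"
      using insert.IH[OF vk(2)] insert.prems insert.hyps by (simp add: add.assoc)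
    have "wt (v + s k) (y + ?S \<omega>) = wt (v + s k) y * exp (u * ?S \<omega>)" for \<omega>
      by (simp add: wt_def exp_add[symmetric] algebra_simps)
    then have "(\<integral>\<omega>. wt (v + s k) (y + ?S \<omega>) \<partial>Pi\<^sub>M I (\<lambda>_. F)) =
       (\<integral>\<omega>. wt (v + s k) y * exp (u * ?S \<omega>) \<partial>Pi\<^sub>M I (\<lambda>_. F))"
      by simp
    also have "\<dots> = wt (v + s k) y * (\<integral>\<omega>. exp (u * ?S \<omega>) \<partial>Pi\<^sub>M I (\<lambda>_. F))"
      by simp
    also have "\<dots> \<le> wt (v + s k) y * exp (\<Sum>i\<in>I. u * m i + u\<^sup>2 * s i / 2 + u ^ 3 * b * s i)"
      by (intro mult_left_mono exp_sum_le insert.hyps wt_nonneg)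
    also have "(\<Sum>i\<in>I. u * m i + u\<^sup>2 * s i / 2 + u ^ 3 * b * s i) = u\<^sup>2 * (\<Sum>i\<in>I. s i) / 2 + ?E"
      by (simp add: sum.distrib sum_distrib_left sum_divide_distrib)
    also have "wt (v + s k) y * exp (u\<^sup>2 * (\<Sum>i\<in>I. s i) / 2 + ?E) = wt ?v y * exp ?E"
      by (simp add: wt_def exp_add[symmetric] algebra_simps add_divide_distrib)
    finally show "(\<integral>\<omega>. wt (v + s k) (y + ?S \<omega>) \<partial>Pi\<^sub>M I (\<lambda>_. F)) \<le> wt ?v y * exp ?E" .
  qed
  also have "\<dots> = heat ?v y + (\<Sum>i\<in>insert k I. err i) * wt ?v y * exp ?E"
    using insert.hyps by (simp add: algebra_simps)
  \<comment> \<open>The factor contributed by k is at least 1, so letting the exponent run over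
    \<open>insert k I\<close> restores the form of the induction claim.\<close>
  also have "\<dots> \<le> heat ?v y + (\<Sum>i\<in>insert k I. err i) * wt ?v y * exp (\<Sum>i\<in>insert k I. u * m i + u ^ 3 * b * s i)"
    using insert.hyps u b m_nonneg[of k] s_nonneg[of k]
    by (intro add_left_mono mult_left_mono mult_nonneg_nonneg wt_nonneg sum_nonneg err_nonneg) auto
  finally show ?case
    using insert.hyps by (simp add: add.assoc)
qed

end

subsection \<open>Truncation\<close>

definition truncate :: "real \<Rightarrow> real \<Rightarrow> real" where
  "truncate b w = (if \<bar>w\<bar> \<le> b then w else 0)"

lemma truncate_measurable [measurable]: "truncate b \<in> borel_measurable borel"
  unfolding truncate_def by measurable

lemma abs_truncate_le: "0 \<le> b \<Longrightarrow> \<bar>truncate b w\<bar> \<le> b"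
  by (simp add: truncate_def)

text \<open>All three are (w / b)^(q - e) >= 1, for e = 0, 1, 2. Through them the q-th moment
  controls the probability of exceeding the truncation level and the first and second moments cut
  off there.\<close>

lemma powr_tail_bounds:
  fixes w b q :: real
  assumes b: "0 < b" "b < w" and q: "2 \<le> q"
  shows "1 \<le> w powr q * b powr - q"
    and "w \<le> w powr q * b powr (1 - q)"
    and "w\<^sup>2 \<le> w powr q * b powr (2 - q)"
proof -
  have r: "1 \<le> (w / b) powr e" if "e \<ge> 0" for e
    using b that by (intro ge_one_powr_ge_zero) auto
  have *: "w powr e \<le> w powr q * b powr (e - q)" if "e \<le> q" for e
  proof -
    have "w powr e * 1 \<le> w powr e * (w / b) powr (q - e)"
      using that by (intro mult_left_mono r) auto
    also have "\<dots> = w powr q * b powr (e - q)"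
      using b by (simp add: powr_divide powr_diff field_simps)
    finally show ?thesis by simp
  qed
  show "1 \<le> w powr q * b powr - q"
    using *[of 0] b q by simp
  show "w \<le> w powr q * b powr (1 - q)"
    using *[of 1] b q by simp
  show "w\<^sup>2 \<le> w powr q * b powr (2 - q)"
    using *[of 2] b q by simp
qed

lemma standardized_lawD:
  assumes "standardized_law F"
  shows "prob_space F" "sets F = sets borel" "space F = UNIV"
    and "integrable F (\<lambda>t. t)" "integrable F (\<lambda>t. t\<^sup>2)"
    and "integral\<^sup>L F (\<lambda>t. t) = 0" "integral\<^sup>L F (\<lambda>t. t\<^sup>2) = 1"
proof -
  interpret real_distribution F
    using assms by (simp add: standardized_law_def)
  show "prob_space F" "sets F = sets borel" "space F = UNIV"
    by unfold_locales simp_all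
  show "integrable F (\<lambda>t. t)" "integrable F (\<lambda>t. t\<^sup>2)" "integral\<^sup>L F (\<lambda>t. t) = 0"
    using assms by (auto simp: standardized_law_def)
  then show "integral\<^sup>L F (\<lambda>t. t\<^sup>2) = 1"
    using assms by (simp add: standardized_law_def)
qed

lemma truncation_moments:
  fixes a b q C :: real
  assumes F: "standardized_law F" and q: "2 < q"
    and iq: "integrable F (\<lambda>t. \<bar>t\<bar> powr q)" and C: "integral\<^sup>L F (\<lambda>t. \<bar>t\<bar> powr q) \<le> C"
    and b: "0 < b" "b \<le> 1"
  shows "\<bar>\<integral>t. truncate b (a * t) \<partial>F\<bar> \<le> C * \<bar>a\<bar> powr q * b powr (1 - q)"
    and "(\<integral>t. (truncate b (a * t))\<^sup>2 \<partial>F) \<le> a\<^sup>2"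
    and "a\<^sup>2 - (\<integral>t. (truncate b (a * t))\<^sup>2 \<partial>F) \<le> C * \<bar>a\<bar> powr q * b powr (1 - q)"
    and "measure F {t. b < \<bar>a * t\<bar>} \<le> C * \<bar>a\<bar> powr q * b powr - q"
proof -
  interpret prob_space F using standardized_lawD(1)[OF F] .
  note [measurable_cong, simp] = standardized_lawD(2)[OF F]
  note [simp] = standardized_lawD(3)[OF F]
  have i1: "integrable F (\<lambda>t. a * t)" and i2: "integrable F (\<lambda>t. (a * t)\<^sup>2)"
    using standardized_lawD(4,5)[OF F] by (simp_all add: power_mult_distrib)
  have e2: "(\<integral>t. (a * t)\<^sup>2 \<partial>F) = a\<^sup>2"
    using standardized_lawD(7)[OF F] by (simp add: power_mult_distrib)
  have t1: "integrable F (\<lambda>t. truncate b (a * t))"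
    by (rule integrable_const_bound[of _ b]) (use abs_truncate_le b in auto)
  have t2: "integrable F (\<lambda>t. (truncate b (a * t))\<^sup>2)"
    by (rule integrable_const_bound[of _ "b\<^sup>2"])
      (use abs_truncate_le[of b] b in \<open>auto simp: abs_le_square_iff[symmetric]\<close>)
  have iaq: "integrable F (\<lambda>t. \<bar>a * t\<bar> powr q * k)" for k
    using iq by (auto simp: abs_mult powr_mult)
  have eaq: "(\<integral>t. \<bar>a * t\<bar> powr q * k \<partial>F) \<le> C * \<bar>a\<bar> powr q * k" if "0 \<le> k" for k
  proof -
    have "(\<integral>t. \<bar>a * t\<bar> powr q * k \<partial>F) = \<bar>a\<bar> powr q * k * (\<integral>t. \<bar>t\<bar> powr q \<partial>F)"
      by (simp add: abs_mult powr_mult mult_ac)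
    also have "\<dots> \<le> \<bar>a\<bar> powr q * k * C"
      using C that by (intro mult_left_mono) auto
    finally show ?thesis by (simp add: mult_ac)
  qed
  \<comment> \<open>Since the mean is zero, the truncated mean is minus the mean of the part cut
    off.\<close>
  have "\<bar>\<integral>t. truncate b (a * t) \<partial>F\<bar> = \<bar>(\<integral>t. truncate b (a * t) - a * t \<partial>F)\<bar>"
    using t1 i1 standardized_lawD(6)[OF F] by simp
  also have "\<dots> \<le> (\<integral>t. \<bar>truncate b (a * t) - a * t\<bar> \<partial>F)"
    by (rule integral_abs_bound)
  also have "\<dots> \<le> (\<integral>t. \<bar>a * t\<bar> powr q * b powr (1 - q) \<partial>F)"
    using t1 i1 iaq powr_tail_bounds(2)[OF b(1)] q
    by (intro integral_mono) (auto simp: truncate_def not_le)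
  also have "\<dots> \<le> C * \<bar>a\<bar> powr q * b powr (1 - q)"
    by (rule eaq) simp
  finally show "\<bar>\<integral>t. truncate b (a * t) \<partial>F\<bar> \<le> C * \<bar>a\<bar> powr q * b powr (1 - q)" .
  have "(\<integral>t. (truncate b (a * t))\<^sup>2 \<partial>F) \<le> (\<integral>t. (a * t)\<^sup>2 \<partial>F)"
    using t2 i2 by (intro integral_mono) (auto simp: truncate_def)
  then show "(\<integral>t. (truncate b (a * t))\<^sup>2 \<partial>F) \<le> a\<^sup>2"
    using e2 by simp
  have "a\<^sup>2 - (\<integral>t. (truncate b (a * t))\<^sup>2 \<partial>F) = (\<integral>t. (a * t)\<^sup>2 - (truncate b (a * t))\<^sup>2 \<partial>F)"
    using i2 t2 e2 by simp
  also have "\<dots> \<le> (\<integral>t. \<bar>a * t\<bar> powr q * b powr (2 - q) \<partial>F)"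
  proof (rule integral_mono)
    fix t
    show "(a * t)\<^sup>2 - (truncate b (a * t))\<^sup>2 \<le> \<bar>a * t\<bar> powr q * b powr (2 - q)"
      using powr_tail_bounds(3)[OF b(1), of "\<bar>a * t\<bar>" q] q by (auto simp: truncate_def not_le)
  qed (use i2 t2 iaq in auto)
  also have "\<dots> \<le> C * \<bar>a\<bar> powr q * b powr (2 - q)"
    by (rule eaq) simp
  \<comment> \<open>The exponent is weakened from 2 - q to 1 - q, using b <= 1, so that one quantity
    bounds both the bias and the variance defect.\<close>
  also have "\<dots> \<le> C * \<bar>a\<bar> powr q * b powr (1 - q)"
  proof -
    have "0 \<le> (\<integral>t. \<bar>t\<bar> powr q \<partial>F)" by (rule Bochner_Integration.integral_nonneg) auto
    then have "0 \<le> C" using C by linarith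
    then show ?thesis
      using b by (intro mult_left_mono powr_mono') auto
  qed
  finally show "a\<^sup>2 - (\<integral>t. (truncate b (a * t))\<^sup>2 \<partial>F) \<le> C * \<bar>a\<bar> powr q * b powr (1 - q)" .
  have "measure F {t. b < \<bar>a * t\<bar>} = (\<integral>t. indicator {t. b < \<bar>a * t\<bar>} t \<partial>F)"
    by simp
  also have "\<dots> \<le> (\<integral>t. \<bar>a * t\<bar> powr q * b powr - q \<partial>F)"
  proof (rule integral_mono[OF _ iaq])
    show "integrable F (indicator {t. b < \<bar>a * t\<bar>} :: real \<Rightarrow> real)"
      by (simp add: less_top[symmetric])
    fix t
    show "indicator {t. b < \<bar>a * t\<bar>} t \<le> \<bar>a * t\<bar> powr q * b powr - q"
      using powr_tail_bounds(1)[OF b(1), of "\<bar>a * t\<bar>" q] q by (auto simp: indicator_def)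
  qed
  also have "\<dots> \<le> C * \<bar>a\<bar> powr q * b powr - q"
    by (rule eaq) simp
  finally show "measure F {t. b < \<bar>a * t\<bar>} \<le> C * \<bar>a\<bar> powr q * b powr - q" .
qed

text \<open>Some summand exceeds b in absolute value with probability at most B * b^(-q) (the event
  \<open>Z\<close>); off \<open>Z\<close> the sum equals its truncated version \<open>S\<close>. The
  indicator of u <= S, times \<Phi> (h / d), is at most heat (d^2) (h - u + S): the shift h makes
  the smoothed step nearly 1 at the threshold when h / d is large. \<open>heat_sum_le\<close> then
  runs the clock from d^2 to 1 + d^2.\<close>

lemma weighted_sum_tail:
  fixes a :: "nat \<Rightarrow> real" and b q C u d h B :: real
  assumes F: "standardized_law F" and q: "2 < q"
    and iq: "integrable F (\<lambda>t. \<bar>t\<bar> powr q)" and C: "integral\<^sup>L F (\<lambda>t. \<bar>t\<bar> powr q) \<le> C"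
    and I: "finite I" and a2: "(\<Sum>i\<in>I. (a i)\<^sup>2) = 1"
    and B: "C * (\<Sum>i\<in>I. \<bar>a i\<bar> powr q) \<le> B" and ab: "\<And>i. i \<in> I \<Longrightarrow> \<bar>a i\<bar> \<le> b"
    and b: "0 < b" "b \<le> 1" and u: "1 \<le> u" and ub: "u * b \<le> 1"
    and d: "0 < d" "d \<le> 1"
  shows "\<Phi> (h / d) * measure (Pi\<^sub>M I (\<lambda>_. F)) {\<omega> \<in> space (Pi\<^sub>M I (\<lambda>_. F)). u \<le> (\<Sum>i\<in>I. a i * \<omega> i)}
    \<le> B * b powr - q + \<Phi> ((h - u) / sqrt (1 + d\<^sup>2))
      + (2 * (B * b powr (1 - q)) + 2 * b) * (81000 * u ^ 3 / d ^ 4)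
        * exp (u * (h - u) + u\<^sup>2 * (1 + d\<^sup>2) / 2 + u * (B * b powr (1 - q)) + u ^ 3 * b)"
proof -
  \<comment> \<open>The locale bounds all indices, so the coefficients outside \<open>I\<close> are
    set to 0.\<close>
  define a' where "a' = (\<lambda>i. if i \<in> I then a i else 0)"
  define X where "X = (\<lambda>i t. truncate b (a' i * t))"
  define m where "m = (\<lambda>i. C * \<bar>a' i\<bar> powr q * b powr (1 - q))"
  define s where "s = (\<lambda>i. (a' i)\<^sup>2)"
  note tm = truncation_moments[OF F q iq C b]
  note [measurable_cong, simp] = standardized_lawD(2)[OF F]
  interpret prob_space F using standardized_lawD(1)[OF F] .
  interpret small_summands F X m s b u d
  proof unfold_locales
    show "X i \<in> borel_measurable F" for i
      unfolding X_def by measurable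
    show "\<bar>X i z\<bar> \<le> b" for i z
      using b by (simp add: X_def abs_truncate_le)
    show "\<bar>expectation (X i)\<bar> \<le> m i" "expectation (\<lambda>z. (X i z)\<^sup>2) \<le> s i" for i
      unfolding X_def m_def s_def by (rule tm)+
    show "s i \<le> b\<^sup>2" for i
      using ab[of i] b by (simp add: s_def a'_def abs_le_square_iff[symmetric])
  qed (use b u ub d in auto)
  let ?P = "Pi\<^sub>M I (\<lambda>_. F)"
  interpret Q: prob_space ?P by (rule prob_space_PiM_F)
  note [measurable] = sum_measurable[of I I]
  have ai: "(\<lambda>\<omega>. a i * \<omega> i) \<in> borel_measurable ?P" if "i \<in> I" for i
    using that by measurable
  have [measurable]: "(\<lambda>\<omega>. \<Sum>i\<in>I. a i * \<omega> i) \<in> borel_measurable ?P"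
    by (intro borel_measurable_sum ai)
  have msum: "(\<Sum>i\<in>I. m i) \<le> B * b powr (1 - q)"
  proof -
    have "(\<Sum>i\<in>I. m i) = (C * (\<Sum>i\<in>I. \<bar>a i\<bar> powr q)) * b powr (1 - q)"
      by (simp add: m_def a'_def sum_distrib_left sum_distrib_right mult_ac cong: sum.cong)
    also have "\<dots> \<le> B * b powr (1 - q)"
      using B by (intro mult_right_mono) auto
    finally show ?thesis .
  qed
  have ssum: "(\<Sum>i\<in>I. s i) = 1"
    using a2 by (simp add: s_def a'_def cong: sum.cong)
  have esum: "(\<Sum>i\<in>I. err i) \<le> 2 * (B * b powr (1 - q)) + 2 * b"
  proof -
    have "(\<Sum>i\<in>I. err i) \<le> (\<Sum>i\<in>I. m i + m i + 2 * b * s i)"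
    proof (rule sum_mono)
      fix i
      have "s i - expectation (\<lambda>z. (X i z)\<^sup>2) \<le> m i"
        unfolding s_def X_def m_def by (rule tm)
      then show "err i \<le> m i + m i + 2 * b * s i"
        by (simp add: err_def)
    qed
    also have "\<dots> = 2 * (\<Sum>i\<in>I. m i) + 2 * b * (\<Sum>i\<in>I. s i)"
      by (simp add: sum.distrib sum_distrib_left)
    finally show ?thesis using msum ssum by simp
  qed
  define Z where "Z = {\<omega> \<in> space ?P. \<exists>i\<in>I. b < \<bar>a i * \<omega> i\<bar>}"
  have Zm: "Z \<in> sets ?P"
    unfolding Z_def using I ai by measurable
  have comp: "measure ?P {\<omega> \<in> space ?P. b < \<bar>a i * \<omega> i\<bar>} = measure F {t. b < \<bar>a i * t\<bar>}"
    if "i \<in> I" for i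
  proof -
    have "F = distr ?P F (\<lambda>\<omega>. \<omega> i)"
      using distr_PiM_component[of I "\<lambda>_. F" i] that I prob_space_axioms by simp
    then have "measure F {t. b < \<bar>a i * t\<bar>} = measure (distr ?P F (\<lambda>\<omega>. \<omega> i)) {t. b < \<bar>a i * t\<bar>}"
      by simp
    also have "\<dots> = measure ?P ((\<lambda>\<omega>. \<omega> i) -` {t. b < \<bar>a i * t\<bar>} \<inter> space ?P)"
      using that by (intro measure_distr) auto
    also have "(\<lambda>\<omega>. \<omega> i) -` {t. b < \<bar>a i * t\<bar>} \<inter> space ?P = {\<omega> \<in> space ?P. b < \<bar>a i * \<omega> i\<bar>}"
      by auto
    finally show ?thesis by simp
  qed
  have Zle: "measure ?P Z \<le> B * b powr - q"
  proof -
    have "Z = (\<Union>i\<in>I. {\<omega> \<in> space ?P. b < \<bar>a i * \<omega> i\<bar>})"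
      by (auto simp: Z_def)
    then have "measure ?P Z \<le> (\<Sum>i\<in>I. measure ?P {\<omega> \<in> space ?P. b < \<bar>a i * \<omega> i\<bar>})"
      using I ai by (auto intro!: Q.finite_measure_subadditive_finite)
    also have "\<dots> = (\<Sum>i\<in>I. measure F {t. b < \<bar>a i * t\<bar>})"
      by (intro sum.cong refl comp)
    also have "\<dots> \<le> (\<Sum>i\<in>I. C * \<bar>a i\<bar> powr q * b powr - q)"
      by (intro sum_mono tm)
    also have "\<dots> = (C * (\<Sum>i\<in>I. \<bar>a i\<bar> powr q)) * b powr - q"
      by (simp add: sum_distrib_left sum_distrib_right mult_ac)
    also have "\<dots> \<le> B * b powr - q"
      using B by (intro mult_right_mono) auto
    finally show ?thesis .
  qed
  define S where "S = (\<lambda>\<omega>. \<Sum>i\<in>I. X i (\<omega> i))"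
  have [measurable]: "S \<in> borel_measurable ?P"
    unfolding S_def by measurable
  have dd: "sqrt (d\<^sup>2) = d" using d by simp
  have "\<Phi> (h / d) * measure ?P {\<omega> \<in> space ?P. u \<le> S \<omega>}
      = (\<integral>\<omega>. \<Phi> (h / d) * indicator {\<omega> \<in> space ?P. u \<le> S \<omega>} \<omega> \<partial>?P)"
    by simp
  also have "\<dots> \<le> (\<integral>\<omega>. heat (d\<^sup>2) ((h - u) + S \<omega>) \<partial>?P)"
  proof (rule integral_mono)
    show "integrable ?P (\<lambda>\<omega>. \<Phi> (h / d) * indicator {\<omega> \<in> space ?P. u \<le> S \<omega>} \<omega>)"
      by (intro integrable_mult_right) (simp add: less_top[symmetric])
    show "integrable ?P (\<lambda>\<omega>. heat (d\<^sup>2) ((h - u) + S \<omega>))"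
      by (rule Q.integrable_const_bound[of _ 1]) (use heat_bounds in auto)
    fix \<omega>
    show "\<Phi> (h / d) * indicator {\<omega> \<in> space ?P. u \<le> S \<omega>} \<omega> \<le> heat (d\<^sup>2) ((h - u) + S \<omega>)"
      using d by (auto simp: indicator_def heat_def dd intro!: std_normal_cdf_mono divide_right_mono)
  qed
  also have "\<dots> \<le> heat (d\<^sup>2 + 1) (h - u)
      + (\<Sum>i\<in>I. err i) * wt (d\<^sup>2 + 1) (h - u) * exp (\<Sum>i\<in>I. u * m i + u ^ 3 * b * s i)"
    using heat_sum_le[OF I order_refl, of "h - u"] d ssum
    by (simp add: S_def power_le_one)
  also have "(\<Sum>i\<in>I. u * m i + u ^ 3 * b * s i) = u * (\<Sum>i\<in>I. m i) + u ^ 3 * b * (\<Sum>i\<in>I. s i)"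
    by (simp add: sum.distrib sum_distrib_left)
  also have "(\<Sum>i\<in>I. err i) * wt (d\<^sup>2 + 1) (h - u) * exp (u * (\<Sum>i\<in>I. m i) + u ^ 3 * b * (\<Sum>i\<in>I. s i))
     \<le> (2 * (B * b powr (1 - q)) + 2 * b) * wt (d\<^sup>2 + 1) (h - u) * exp (u * (B * b powr (1 - q)) + u ^ 3 * b)"
  proof (intro mult_mono esum wt_nonneg order_refl mult_nonneg_nonneg sum_nonneg err_nonneg)
    have "u * (\<Sum>i\<in>I. m i) \<le> u * (B * b powr (1 - q))"
      using msum u by (intro mult_left_mono) auto
    then show "exp (u * (\<Sum>i\<in>I. m i) + u ^ 3 * b * (\<Sum>i\<in>I. s i)) \<le> exp (u * (B * b powr (1 - q)) + u ^ 3 * b)"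
      using ssum by simp
    have "0 \<le> (\<Sum>i\<in>I. err i)" by (intro sum_nonneg err_nonneg)
    also note esum
    finally show "0 \<le> 2 * (B * b powr (1 - q)) + 2 * b" .
    then show "0 \<le> 2 * (B * b powr (1 - q)) + 2 * b" .
  qed simp_all
  also have "E * wt (d\<^sup>2 + 1) (h - u) * exp (x + y) = E * (81000 * u ^ 3 / d ^ 4)
        * exp (u * (h - u) + u\<^sup>2 * (1 + d\<^sup>2) / 2 + x + y)" for E x y
    by (simp add: wt_def exp_add add.commute[of 1 "d\<^sup>2"])
  finally have main: "\<Phi> (h / d) * measure ?P {\<omega> \<in> space ?P. u \<le> S \<omega>} \<le> \<Phi> ((h - u) / sqrt (1 + d\<^sup>2))
      + (2 * (B * b powr (1 - q)) + 2 * b) * (81000 * u ^ 3 / d ^ 4)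
        * exp (u * (h - u) + u\<^sup>2 * (1 + d\<^sup>2) / 2 + u * (B * b powr (1 - q)) + u ^ 3 * b)"
    by (simp add: heat_def add.commute[of 1 "d\<^sup>2"])
  have eqS: "(\<Sum>i\<in>I. a i * \<omega> i) = S \<omega>" if "\<omega> \<in> space ?P" "\<omega> \<notin> Z" for \<omega>
    using that by (auto simp: S_def X_def a'_def Z_def truncate_def not_less intro!: sum.cong)
  have "measure ?P {\<omega> \<in> space ?P. u \<le> (\<Sum>i\<in>I. a i * \<omega> i)} \<le> measure ?P (Z \<union> {\<omega> \<in> space ?P. u \<le> S \<omega>})"
    using Zm by (intro Q.finite_measure_mono) (auto simp: eqS)
  also have "\<dots> \<le> measure ?P Z + measure ?P {\<omega> \<in> space ?P. u \<le> S \<omega>}"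
    using Zm by (intro measure_Un_le) auto
  finally have "\<Phi> (h / d) * measure ?P {\<omega> \<in> space ?P. u \<le> (\<Sum>i\<in>I. a i * \<omega> i)}
     \<le> \<Phi> (h / d) * (measure ?P Z + measure ?P {\<omega> \<in> space ?P. u \<le> S \<omega>})"
    by (intro mult_left_mono) auto
  also have "\<dots> \<le> measure ?P Z + \<Phi> (h / d) * measure ?P {\<omega> \<in> space ?P. u \<le> S \<omega>}"
    by (simp add: distrib_left mult_left_le_one_le)
  finally show ?thesis
    using Zle main by linarith
qed

subsection \<open>Lower tail of the empirical second moment\<close>

text \<open>Up to 1 the second order bound 1 - y + y^2 is weakened by y^2 <= y^a; beyond 1 already y
  <= y^a suffices. An exponent a < 2 makes this usable for y = h * t^2 under fewer than four
  moments.\<close>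

lemma exp_minus_le_powr:
  fixes y a :: real
  assumes "0 \<le> y" "1 \<le> a" "a \<le> 2"
  shows "exp (- y) \<le> 1 - y + y powr a"
proof (cases "y \<le> 1")
  case True
  have "exp (- y) \<le> 1 - y + y\<^sup>2"
  proof -
    obtain t where t: "\<bar>t\<bar> \<le> \<bar>- y\<bar>" "exp (- y) = (\<Sum>m<3. (- y) ^ m / fact m) + exp t / fact 3 * (- y) ^ 3"
      using Maclaurin_exp_le[of "- y" 3] by blast
    have "exp t / fact 3 * (- y) ^ 3 \<le> 0"
      using assms by (intro mult_nonneg_nonpos) auto
    then show ?thesis
      unfolding t(2) by (simp add: eval_nat_numeral) (use zero_le_square[of y] in linarith)
  qed
  also have "y\<^sup>2 \<le> y powr a"
    using powr_mono'[of a 2 y] True assms by simp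
  finally show ?thesis by simp
next
  case False
  have "y = y powr 1" using False by simp
  also have "\<dots> \<le> y powr a" using False assms by (intro powr_mono) auto
  finally have "y \<le> y powr a" .
  moreover have "exp (- y) \<le> 1" using assms by simp
  ultimately show ?thesis by linarith
qed

text \<open>Chernoff bound with exp (- h * t^2), which never exceeds 1, so large values of t do no
  harm. The remainder h^a * |t|^(2a) is integrated by means of |t|^(2a) <= 1 + |t|^q.\<close>

lemma sum_squares_lower_tail:
  fixes q C h r a :: real
  assumes F: "standardized_law F" and q: "2 < q"
    and iq: "integrable F (\<lambda>t. \<bar>t\<bar> powr q)" and C: "integral\<^sup>L F (\<lambda>t. \<bar>t\<bar> powr q) \<le> C"
    and I: "finite I" and h: "0 < h" and a: "1 \<le> a" "a \<le> 2" "2 * a \<le> q"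
  shows "measure (Pi\<^sub>M I (\<lambda>_. F))
      {\<omega> \<in> space (Pi\<^sub>M I (\<lambda>_. F)). (\<Sum>i\<in>I. (\<omega> i)\<^sup>2) \<le> real (card I) * (1 - r)}
    \<le> exp (- real (card I) * (h * r - (1 + C) * h powr a))"
proof -
  interpret prob_space F using standardized_lawD(1)[OF F] .
  note [measurable_cong, simp] = standardized_lawD(2)[OF F]
  interpret P: product_sigma_finite "\<lambda>_::'b. F" by unfold_locales
  let ?P = "Pi\<^sub>M I (\<lambda>_. F)"
  interpret Q: prob_space ?P by (intro prob_space_PiM prob_space_axioms)
  have i2: "integrable F (\<lambda>t. t\<^sup>2)" and e2: "(\<integral>t. t\<^sup>2 \<partial>F) = 1"
    using standardized_lawD[OF F] by auto
  have ie: "integrable F (\<lambda>t. exp (- h * t\<^sup>2))"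
    by (rule integrable_const_bound[of _ 1]) (use h in auto)
  have pt: "exp (- h * t\<^sup>2) \<le> 1 - h * t\<^sup>2 + h powr a * (1 + \<bar>t\<bar> powr q)" for t
  proof -
    have "exp (- (h * t\<^sup>2)) \<le> 1 - h * t\<^sup>2 + (h * t\<^sup>2) powr a"
      using h a by (intro exp_minus_le_powr) auto
    also have "(h * t\<^sup>2) powr a = h powr a * \<bar>t\<bar> powr (2 * a)"
    proof -
      have "(t\<^sup>2) powr a = \<bar>t\<bar> powr (2 * a)"
        using powr_powr[of "\<bar>t\<bar>" 2 a] by simp
      then show ?thesis using h by (simp add: powr_mult)
    qed
    also have "\<dots> \<le> h powr a * (1 + \<bar>t\<bar> powr q)"
    proof (intro mult_left_mono)
      show "\<bar>t\<bar> powr (2 * a) \<le> 1 + \<bar>t\<bar> powr q"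
      proof (cases "\<bar>t\<bar> \<le> 1")
        case True
        then have "\<bar>t\<bar> powr (2 * a) \<le> 1" using a by (intro powr_le1) auto
        then show ?thesis by (simp add: add_increasing2)
      next
        case False
        then have "\<bar>t\<bar> powr (2 * a) \<le> \<bar>t\<bar> powr q" using a by (intro powr_mono) auto
        then show ?thesis by simp
      qed
    qed simp
    finally show ?thesis by simp
  qed
  have "expectation (\<lambda>t. exp (- h * t\<^sup>2)) \<le> expectation (\<lambda>t. 1 - h * t\<^sup>2 + h powr a * (1 + \<bar>t\<bar> powr q))"
    using ie i2 iq pt by (intro integral_mono) auto
  also have "\<dots> = 1 - h + h powr a * (1 + expectation (\<lambda>t. \<bar>t\<bar> powr q))"
    using i2 iq e2 by (simp add: prob_space)
  also have "\<dots> \<le> 1 - h + h powr a * (1 + C)"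
    using C by (intro add_left_mono mult_left_mono) auto
  also have "\<dots> \<le> exp (- h + h powr a * (1 + C))"
    using exp_ge_add_one_self[of "- h + h powr a * (1 + C)"]
    by (simp only: add.assoc[symmetric] diff_conv_add_uminus)
  finally have mgf: "expectation (\<lambda>t. exp (- h * t\<^sup>2)) \<le> exp (- h + h powr a * (1 + C))" .
  define K where "K = real (card I) * (1 - r)"
  have [measurable]: "(\<lambda>\<omega>. \<Sum>i\<in>I. (\<omega> i)\<^sup>2) \<in> borel_measurable ?P"
    by measurable
  have prod: "exp (h * (K - (\<Sum>i\<in>I. (\<omega> i)\<^sup>2))) = exp (h * K) * (\<Prod>i\<in>I. exp (- h * (\<omega> i)\<^sup>2))" for \<omega>
  proof -
    have "(\<Prod>i\<in>I. exp (- h * (\<omega> i)\<^sup>2)) = exp (\<Sum>i\<in>I. - h * (\<omega> i)\<^sup>2)"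
      using I by (simp add: exp_sum)
    also have "(\<Sum>i\<in>I. - h * (\<omega> i)\<^sup>2) = - h * (\<Sum>i\<in>I. (\<omega> i)\<^sup>2)"
      by (simp add: sum_distrib_left sum_negf)
    finally show ?thesis by (simp add: exp_add[symmetric] algebra_simps)
  qed
  have ip: "integrable ?P (\<lambda>\<omega>. \<Prod>i\<in>I. exp (- h * (\<omega> i)\<^sup>2))"
    by (rule P.product_integrable_prod[OF I ie])
  have "measure ?P {\<omega> \<in> space ?P. (\<Sum>i\<in>I. (\<omega> i)\<^sup>2) \<le> K}
      = (\<integral>\<omega>. indicator {\<omega> \<in> space ?P. (\<Sum>i\<in>I. (\<omega> i)\<^sup>2) \<le> K} \<omega> \<partial>?P)"
    by simp
  also have "\<dots> \<le> (\<integral>\<omega>. exp (h * (K - (\<Sum>i\<in>I. (\<omega> i)\<^sup>2))) \<partial>?P)"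
  proof (rule integral_mono)
    show "integrable ?P (indicator {\<omega> \<in> space ?P. (\<Sum>i\<in>I. (\<omega> i)\<^sup>2) \<le> K} :: _ \<Rightarrow> real)"
      by (simp add: less_top[symmetric])
    show "integrable ?P (\<lambda>\<omega>. exp (h * (K - (\<Sum>i\<in>I. (\<omega> i)\<^sup>2))))"
      unfolding prod by (intro integrable_mult_right ip)
    fix \<omega>
    show "indicator {\<omega> \<in> space ?P. (\<Sum>i\<in>I. (\<omega> i)\<^sup>2) \<le> K} \<omega> \<le> exp (h * (K - (\<Sum>i\<in>I. (\<omega> i)\<^sup>2)))"
      using h by (auto simp: indicator_def)
  qed
  also have "\<dots> = exp (h * K) * (\<integral>\<omega>. (\<Prod>i\<in>I. exp (- h * (\<omega> i)\<^sup>2)) \<partial>?P)"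
    unfolding prod by simp
  also have "(\<integral>\<omega>. (\<Prod>i\<in>I. exp (- h * (\<omega> i)\<^sup>2)) \<partial>?P) = (\<Prod>i\<in>I. expectation (\<lambda>t. exp (- h * t\<^sup>2)))"
    by (rule P.product_integral_prod[OF I ie])
  also have "\<dots> \<le> (\<Prod>i\<in>I. exp (- h + h powr a * (1 + C)))"
    by (intro prod_mono conjI mgf Bochner_Integration.integral_nonneg) auto
  also have "\<dots> = exp (real (card I) * (- h + h powr a * (1 + C)))"
    by (simp add: exp_of_nat_mult)
  finally have "measure ?P {\<omega> \<in> space ?P. (\<Sum>i\<in>I. (\<omega> i)\<^sup>2) \<le> K}
    \<le> exp (h * K) * exp (real (card I) * (- h + h powr a * (1 + C)))"
    by simp
  also have "\<dots> = exp (- real (card I) * (h * r - (1 + C) * h powr a))"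
    by (simp add: K_def exp_add[symmetric] algebra_simps)
  finally show ?thesis
    unfolding K_def .
qed

subsection \<open>Quantiles of the score statistic\<close>

lemma score_stat_measurable [measurable]:
  assumes "sets F = sets borel" "1 \<le> p"
  shows "score_stat n p x \<in> borel_measurable (Pi\<^sub>M {1..n} (\<lambda>_. F))"
proof -
  note [measurable_cong] = assms(1)
  have m: "(\<lambda>\<omega>. \<omega> i) \<in> borel_measurable (Pi\<^sub>M {1..n} (\<lambda>_. F))" if "i \<in> {1..n}" for i
    using that by measurable
  have [simp]: "{1..p} \<noteq> {}"
    using assms(2) by simp
  have "(\<lambda>\<omega>. Max ((\<lambda>j. \<bar>(\<Sum>i=1..n. x i j * \<omega> i) / real n\<bar>) ` {1..p})) \<in> borel_measurable (Pi\<^sub>M {1..n} (\<lambda>_. F))"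
    by (intro borel_measurable_Max borel_measurable_abs borel_measurable_divide
        borel_measurable_sum borel_measurable_times borel_measurable_const m) simp_all
  then show ?thesis
    unfolding score_stat_def sup_norm_def empirical_mean_def
    by (intro borel_measurable_divide borel_measurable_times borel_measurable_sqrt borel_measurable_sum borel_measurable_power
        borel_measurable_const m) simp_all
qed

text \<open>The set defining the quantile is nonempty because u < 1 and bounded below because u > 0;
  right continuity of the distribution function passes the inequality to its infimum.\<close>

lemma cdf_quantile_ge:
  assumes "real_distribution D" "0 < u" "u < 1"
  shows "u \<le> cdf D (quantile D u)"
    and "u \<le> cdf D l \<Longrightarrow> quantile D u \<le> l"
proof -
  interpret real_distribution D by fact
  let ?A = "{t. u \<le> cdf D t}"
  obtain t where "cdf D t > u"
    using order_tendstoD(1)[OF cdf_lim_at_top_prob assms(3)] eventually_happens by fastforce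
  then have ne: "?A \<noteq> {}" by (auto intro: less_imp_le)
  obtain b where b: "cdf D b < u"
    using order_tendstoD(2)[OF cdf_lim_at_bot assms(2)] eventually_happens by fastforce
  have "b \<le> t" if "t \<in> ?A" for t
    using b that cdf_nondecreasing[of t b] by (cases "t \<le> b") auto
  then have bdd: "bdd_below ?A" by (auto simp: bdd_below_def)
  show "u \<le> cdf D l \<Longrightarrow> quantile D u \<le> l"
    unfolding quantile_def by (intro cInf_lower bdd) auto
  have "\<forall>\<^sub>F y in at_right (quantile D u). u \<le> cdf D y"
    unfolding eventually_at_right_field
  proof (intro exI[of _ "quantile D u + 1"] conjI allI impI)
    fix y assume "quantile D u < y"
    then obtain t where "t \<in> ?A" "t < y"
      using cInf_less_iff[OF ne bdd] by (auto simp: quantile_def)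
    then show "u \<le> cdf D y"
      using cdf_nondecreasing[of t y] by auto
  qed simp
  then show "u \<le> cdf D (quantile D u)"
    using cdf_is_right_cont[of "quantile D u"]
    by (intro tendsto_lowerbound[of "cdf D" _ "at_right (quantile D u)"]) (auto simp: continuous_within)
qed

abbreviation score_law :: "nat \<Rightarrow> nat \<Rightarrow> (nat \<Rightarrow> nat \<Rightarrow> real) \<Rightarrow> real measure \<Rightarrow> real measure" where
  "score_law n p x F \<equiv> distr (\<Pi>\<^sub>M i\<in>{1..n}. F) borel (score_stat n p x)"

lemma real_distribution_score_law:
  assumes "standardized_law F" "1 \<le> p"
  shows "real_distribution (score_law n p x F)"
proof -
  interpret prob_space F using standardized_lawD(1)[OF assms(1)] .
  interpret P: prob_space "\<Pi>\<^sub>M i\<in>{1..n}. F" by (intro prob_space_PiM prob_space_axioms)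
  interpret D: prob_space "score_law n p x F"
    by (rule P.prob_space_distr[OF score_stat_measurable[OF standardized_lawD(2)[OF assms(1)] assms(2)]])
  show ?thesis by unfold_locales simp_all
qed

lemma score_stat_cong:
  "(\<And>i. i \<in> {1..n} \<Longrightarrow> e i = e' i) \<Longrightarrow> score_stat n p x e = score_stat n p x e'"
  unfolding score_stat_def empirical_mean_def by simp

text \<open>Independence makes the joint law of the errors a product measure, which transfers the
  probability from \<open>M\<close> to \<open>score_law\<close>; the factor c cancels because it is
  positive. Restricting to \<open>{1..n}\<close> is harmless, as the statistic reads only these
  coordinates.\<close>

lemma regression_model_prob:
  assumes "regression_model M n p x \<epsilon> F" "0 < c"
  shows "\<P>(\<omega> in M. c * score_stat n p x (\<lambda>i. \<epsilon> i \<omega>) \<le> c * l) = cdf (score_law n p x F) l"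
proof -
  have np: "1 \<le> n" "1 \<le> p" and F: "standardized_law F" and M: "prob_space M"
    and ind: "prob_space.indep_vars M (\<lambda>_. borel) \<epsilon> {1..n}" and d: "\<And>i. i \<in> {1..n} \<Longrightarrow> distr M borel (\<epsilon> i) = F"
    using assms by (auto simp: regression_model_def normalized_design_def iid_sample_def)
  interpret prob_space M by fact
  note [measurable_cong] = standardized_lawD(2)[OF F]
  have rv: "random_variable borel (\<epsilon> i)" if "i \<in> {1..n}" for i
    using ind that by (auto simp: indep_vars_def)
  let ?E = "\<lambda>\<omega>. \<lambda>i\<in>{1..n}. \<epsilon> i \<omega>"
  have "distr M (Pi\<^sub>M {1..n} (\<lambda>_. borel)) ?E = (Pi\<^sub>M {1..n} (\<lambda>i. distr M borel (\<epsilon> i)))"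
    using indep_vars_iff_distr_eq_PiM'[where I="{1..n}" and M'="\<lambda>_. borel" and X=\<epsilon>] np rv ind by auto
  also have "\<dots> = Pi\<^sub>M {1..n} (\<lambda>_. F)"
    by (intro PiM_cong refl d)
  finally have P: "distr M (Pi\<^sub>M {1..n} (\<lambda>_. borel)) ?E = Pi\<^sub>M {1..n} (\<lambda>_. F)" .
  have E: "?E \<in> measurable M (Pi\<^sub>M {1..n} (\<lambda>_. borel))"
    using rv by (intro measurable_restrict) auto
  have S: "score_stat n p x \<in> borel_measurable (Pi\<^sub>M {1..n} (\<lambda>_. borel))"
    by (rule score_stat_measurable) (use np in auto)
  have "score_law n p x F = distr M borel (score_stat n p x \<circ> ?E)"
    unfolding P[symmetric] by (rule distr_distr[OF S E])
  also have "score_stat n p x \<circ> ?E = (\<lambda>\<omega>. score_stat n p x (\<lambda>i. \<epsilon> i \<omega>))"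
    by (auto simp: fun_eq_iff intro!: score_stat_cong)
  finally have D: "score_law n p x F = distr M borel (\<lambda>\<omega>. score_stat n p x (\<lambda>i. \<epsilon> i \<omega>))" .
  have m: "(\<lambda>\<omega>. score_stat n p x (\<lambda>i. \<epsilon> i \<omega>)) \<in> borel_measurable M"
    using measurable_compose[OF E S] by (rule subst[rotated, where P="\<lambda>f. f \<in> borel_measurable M"])
      (auto simp: fun_eq_iff intro!: score_stat_cong)
  show ?thesis
    unfolding cdf_def D using assms(2) by (subst measure_distr[OF m]) (auto intro!: arg_cong[where f="measure M"])
qed

lemma cdf_score_quantile_ge:
  assumes "standardized_law F" "1 \<le> p" "0 < u" "u < 1" "score_quantile n p x F u \<le> l"
  shows "u \<le> cdf (score_law n p x F) l"
proof -
  interpret D: real_distribution "score_law n p x F"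
    by (rule real_distribution_score_law[OF assms(1,2)])
  have "u \<le> cdf (score_law n p x F) (score_quantile n p x F u)"
    unfolding score_quantile_def by (rule cdf_quantile_ge(1)[OF D.real_distribution_axioms assms(3,4)])
  also have "\<dots> \<le> cdf (score_law n p x F) l"
    by (rule D.cdf_nondecreasing[OF assms(5)])
  finally show ?thesis .
qed

lemma max_score_quantile_attained:
  assumes "max_well_defined n p x \<F> u"
  obtains F where "F \<in> \<F>" "max_score_quantile n p x \<F> u = score_quantile n p x F u"
    "\<And>G. G \<in> \<F> \<Longrightarrow> score_quantile n p x G u \<le> max_score_quantile n p x \<F> u"
proof -
  obtain F where F: "F \<in> \<F>" "\<And>G. G \<in> \<F> \<Longrightarrow> score_quantile n p x G u \<le> score_quantile n p x F u"
    using assms by (auto simp: max_well_defined_def)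
  have "max_score_quantile n p x \<F> u = score_quantile n p x F u"
    unfolding max_score_quantile_def by (rule Greatest_equality) (use F in auto)
  with F that show thesis by metis
qed

subsection \<open>Moderate deviations\<close>

lemma sup_norm_gr_iff:
  "sup_norm p v > l \<longleftrightarrow> (\<exists>j\<in>{1..p}. l < \<bar>v j\<bar>)" if "1 \<le> p"
  using that by (simp add: sup_norm_def Max_gr_iff)

text \<open>If the statistic exceeds sqrt n * t, then either the empirical second moment is at most
  1 - r, or its root is at least 1 - r and some coordinate sum, scaled by 1 / sqrt n, exceeds t * (1
  - r) in absolute value. The two signs are kept as separate one-sided sums.\<close>

lemma score_stat_union_bound:
  assumes F: "standardized_law F" and np: "1 \<le> n" "1 \<le> p" and t: "0 \<le> t" and r: "0 \<le> r" "r \<le> 1"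
  shows "1 - cdf (score_law n p x F) (sqrt (real n) * t)
    \<le> measure (\<Pi>\<^sub>M i\<in>{1..n}. F) {\<omega> \<in> space (\<Pi>\<^sub>M i\<in>{1..n}. F). (\<Sum>i=1..n. (\<omega> i)\<^sup>2) \<le> real n * (1 - r)}
     + (\<Sum>j=1..p. measure (\<Pi>\<^sub>M i\<in>{1..n}. F) {\<omega> \<in> space (\<Pi>\<^sub>M i\<in>{1..n}. F). t * (1 - r) \<le> (\<Sum>i=1..n. (x i j / sqrt n) * \<omega> i)}
      + measure (\<Pi>\<^sub>M i\<in>{1..n}. F) {\<omega> \<in> space (\<Pi>\<^sub>M i\<in>{1..n}. F). t * (1 - r) \<le> (\<Sum>i=1..n. (- (x i j / sqrt n)) * \<omega> i)})"
    (is "_ \<le> measure ?P ?A + (\<Sum>j=1..p. measure ?P (?U j) + measure ?P (?V j))")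
proof -
  interpret prob_space F using standardized_lawD(1)[OF F] .
  interpret P: prob_space ?P by (intro prob_space_PiM prob_space_axioms)
  interpret D: real_distribution "score_law n p x F"
    by (rule real_distribution_score_law[OF F np(2)])
  note [measurable_cong] = standardized_lawD(2)[OF F]
  have m: "(\<lambda>\<omega>. \<omega> i) \<in> borel_measurable ?P" if "i \<in> {1..n}" for i
    using that by measurable
  have ms: "score_stat n p x \<in> borel_measurable ?P"
    by (rule score_stat_measurable[OF standardized_lawD(2)[OF F] np(2)])
  have s2: "(\<lambda>\<omega>. \<Sum>i=1..n. (\<omega> i)\<^sup>2) \<in> borel_measurable ?P"
    by (intro borel_measurable_sum borel_measurable_power m)
  have s1: "(\<lambda>\<omega>. \<Sum>i=1..n. a i * \<omega> i) \<in> borel_measurable ?P" for a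
    by (intro borel_measurable_sum borel_measurable_times borel_measurable_const m)
  have A: "?A \<in> sets ?P" and U: "?U j \<in> sets ?P" and V: "?V j \<in> sets ?P" for j
    using s2 s1 by measurable
  let ?E = "{\<omega> \<in> space ?P. sqrt (real n) * t < score_stat n p x \<omega>}"
  have "1 - cdf (score_law n p x F) (sqrt (real n) * t) = measure (score_law n p x F) {sqrt (real n) * t<..}"
    using D.prob_compl[of "{..sqrt (real n) * t}"] by (simp add: cdf_def Compl_eq_Diff_UNIV[symmetric])
  also have "\<dots> = measure ?P ?E"
  proof (subst measure_distr[OF ms])
    show "measure ?P (score_stat n p x -` {sqrt (real n) * t<..} \<inter> space ?P) = measure ?P ?E"
      by (rule arg_cong[where f="measure ?P"]) auto
  qed simp
  also have "\<dots> \<le> measure ?P (?A \<union> (\<Union>j\<in>{1..p}. ?U j \<union> ?V j))"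
  proof (rule P.finite_measure_mono)
    show "?E \<subseteq> ?A \<union> (\<Union>j\<in>{1..p}. ?U j \<union> ?V j)"
    proof
      fix \<omega> assume w: "\<omega> \<in> ?E"
      show "\<omega> \<in> ?A \<union> (\<Union>j\<in>{1..p}. ?U j \<union> ?V j)"
      proof (cases "\<omega> \<in> ?A")
        case False
        define e where "e = empirical_mean n (\<lambda>i. (\<omega> i)\<^sup>2)"
        have e: "1 - r < e"
          using False w np by (simp add: e_def empirical_mean_def field_simps)
        then have e0: "0 < e" using r by simp
        \<comment> \<open>1 - r lies between 0 and 1, hence sqrt e >= sqrt (1 - r) >= 1 - r; this
          keeps the lowered level free of roots.\<close>
        have "(1 - r)\<^sup>2 \<le> 1 - r"
          using r by (simp add: power2_eq_square mult_left_le)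
        then have se: "1 - r \<le> sqrt e"
          using e by (intro real_le_rsqrt) simp
        let ?v = "\<lambda>j. empirical_mean n (\<lambda>i. x i j * \<omega> i)"
        have "sqrt (real n) * t * sqrt e < real n * sup_norm p ?v"
          using w e0 by (simp add: score_stat_def e_def[symmetric] pos_less_divide_eq)
        moreover have "sqrt (real n) * t * (1 - r) \<le> sqrt (real n) * t * sqrt e"
          using se t by (intro mult_left_mono) auto
        ultimately have "sqrt (real n) * t * (1 - r) / real n < sup_norm p ?v"
          using np by (simp add: pos_divide_less_eq mult.commute)
        then obtain j where j: "j \<in> {1..p}" "sqrt (real n) * t * (1 - r) / real n < \<bar>?v j\<bar>"
          unfolding sup_norm_gr_iff[OF np(2)] by (elim bexE)
        define S where "S = (\<Sum>i=1..n. (x i j / sqrt n) * \<omega> i)"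
        have sn: "sqrt (real n) * sqrt (real n) = real n" "sqrt (real n) > 0"
          using np by auto
        have "?v j = (\<Sum>i=1..n. x i j * \<omega> i) / (sqrt (real n) * sqrt (real n))"
          by (simp add: empirical_mean_def)
        also have "\<dots> = S / sqrt (real n)"
          by (simp add: S_def sum_divide_distrib)
        finally have v: "?v j = S / sqrt (real n)" .
        have "sqrt (real n) * t * (1 - r) / (sqrt (real n) * sqrt (real n)) < \<bar>S\<bar> / sqrt (real n)"
          using j(2) by (simp add: v)
        moreover have "sqrt (real n) * t * (1 - r) / (sqrt (real n) * sqrt (real n)) = t * (1 - r) / sqrt (real n)"
          using mult_divide_mult_cancel_left[of "sqrt (real n)" "t * (1 - r)" "sqrt (real n)"] sn(2)
          unfolding mult.assoc by auto
        ultimately have "t * (1 - r) < \<bar>S\<bar>"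
          using sn(2) by (metis divide_less_cancel less_asym)
        then have "t * (1 - r) \<le> S \<or> t * (1 - r) \<le> - S"
          by linarith
        moreover have "- S = (\<Sum>i=1..n. (- (x i j / sqrt n)) * \<omega> i)"
          by (simp add: S_def sum_negf)
        ultimately have "\<omega> \<in> ?U j \<union> ?V j"
          using w by (auto simp: S_def)
        then show ?thesis using j by blast
      qed simp
    qed
    show "?A \<union> (\<Union>j\<in>{1..p}. ?U j \<union> ?V j) \<in> sets ?P"
      using A U V by auto
  qed
  also have "\<dots> \<le> measure ?P ?A + measure ?P (\<Union>j\<in>{1..p}. ?U j \<union> ?V j)"
    using A U V by (intro measure_Un_le) auto
  also have "measure ?P (\<Union>j\<in>{1..p}. ?U j \<union> ?V j) \<le> (\<Sum>j=1..p. measure ?P (?U j \<union> ?V j))"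
    using U V by (intro P.finite_measure_subadditive_finite) auto
  also have "\<dots> \<le> (\<Sum>j=1..p. measure ?P (?U j) + measure ?P (?V j))"
    using U V by (intro sum_mono measure_Un_le) auto
  finally show ?thesis by simp
qed

text \<open>\<open>weighted_sum_tail\<close> at u = t * (1 - r), rewritten relative to 1 - \<Phi> t.
  By \<open>std_normal_tail_ge\<close>, exp (- t^2 / 2) <= 27 * t * (1 - \<Phi> t), so each
  exponential error becomes a relative one at the cost of a factor t. \<open>y\<close> bounds the
  loss from lowering the Gaussian level from t to w, and \<open>z\<close> adds the corrections of
  the moment generating function.\<close>

lemma moderate_deviation:
  fixes a :: "nat \<Rightarrow> real" and b q C t r d h B :: real
  assumes F: "standardized_law F" and q: "2 < q"
    and iq: "integrable F (\<lambda>t. \<bar>t\<bar> powr q)" and C: "integral\<^sup>L F (\<lambda>t. \<bar>t\<bar> powr q) \<le> C" "1 \<le> C"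
    and I: "finite I" and a2: "(\<Sum>i\<in>I. (a i)\<^sup>2) = 1"
    and B: "C * (\<Sum>i\<in>I. \<bar>a i\<bar> powr q) \<le> B"
    and b: "0 < b" "b \<le> 1" and Bb: "B * b powr - q \<le> 1"
    and t: "2 \<le> t" and tb: "t * b \<le> 1" and d: "0 < d" "d \<le> 1"
    and h: "0 \<le> h" "h \<le> 1" and r: "0 \<le> r" "r \<le> 1 / 2"
  defines "y \<equiv> t\<^sup>2 * r + t * h + t\<^sup>2 * d\<^sup>2"
  defines "z \<equiv> y + t * b + t ^ 3 * b"
  shows "\<Phi> (h / d) * measure (Pi\<^sub>M I (\<lambda>_. F))
      {\<omega> \<in> space (Pi\<^sub>M I (\<lambda>_. F)). t * (1 - r) \<le> (\<Sum>i\<in>I. a i * \<omega> i)}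
    \<le> (1 - \<Phi> t) * (B * b powr - q / (1 - \<Phi> t) + 1 + 27 * y * exp y
        + 8748000 * (t ^ 4 * b / d ^ 4) * exp z)"
proof -
  define u where "u = t * (1 - r)"
  define w where "w = (u - h) / sqrt (1 + d\<^sup>2)"
  have sum_nn: "0 \<le> (\<Sum>i\<in>I. \<bar>a i\<bar> powr q)" by (intro sum_nonneg) auto
  have Cs: "(\<Sum>i\<in>I. \<bar>a i\<bar> powr q) \<le> C * (\<Sum>i\<in>I. \<bar>a i\<bar> powr q)"
    using mult_right_mono[OF C(2) sum_nn] by simp
  have B0: "0 \<le> B" using B Cs sum_nn by linarith
  have u: "1 \<le> u" "u \<le> t"
    using mult_mono[OF t, of "1/2" "1 - r"] t r by (auto simp: u_def mult_left_le)
  have "u * b \<le> t * b" using u b by (intro mult_right_mono) auto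
  then have ub: "u * b \<le> 1" using tb by linarith
  \<comment> \<open>A coefficient above b would alone push the q-th power sum beyond b^q >= B; thus
    \<open>Bb\<close> forces every coefficient to be small.\<close>
  have ab: "\<bar>a i\<bar> \<le> b" if "i \<in> I" for i
  proof (rule ccontr)
    assume "\<not> \<bar>a i\<bar> \<le> b"
    then have "b powr q < \<bar>a i\<bar> powr q"
      using b q by (intro powr_less_mono2) auto
    also have "\<dots> \<le> (\<Sum>i\<in>I. \<bar>a i\<bar> powr q)"
      using I that by (intro member_le_sum) auto
    also have "\<dots> \<le> B" using Cs B by linarith
    also have "\<dots> \<le> b powr q"
      using Bb b by (simp add: powr_minus field_simps)
    finally show False by simp
  qed
  have Bb1: "B * b powr (1 - q) \<le> b"
  proof -
    have "B * b powr (1 - q) = b * (B * b powr - q)"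
      using b by (simp add: powr_diff powr_minus field_simps)
    also have "\<dots> \<le> b" using Bb b by (simp add: mult_left_le)
    finally show ?thesis .
  qed
  have Bb0: "0 \<le> B * b powr (1 - q)" using B0 by simp
  have T: "exp (- t\<^sup>2 / 2) / (27 * t) \<le> 1 - \<Phi> t"
    using t by (intro std_normal_tail_ge) simp
  have T0: "0 < 1 - \<Phi> t"
    by (rule less_le_trans[OF _ T]) (use t in simp)
  have eT: "exp (- t\<^sup>2 / 2) \<le> 27 * t * (1 - \<Phi> t)"
    using T t by (simp add: field_simps)
  have w: "0 \<le> w" "w \<le> t" "t * (t - w) \<le> y"
  proof -
    have s1: "1 \<le> sqrt (1 + d\<^sup>2)" by simp
    show "0 \<le> w" using u h by (simp add: w_def)
    have "w \<le> (u - h) / 1"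
      unfolding w_def using s1 u h by (intro divide_left_mono mult_pos_pos) linarith+
    then show "w \<le> t" using u h by simp
    \<comment> \<open>The aim is 1 / sqrt (1 + d^2) >= 1 - d^2, so that the smoothing lowers the
      level by at most t * d^2.\<close>
    have "sqrt (1 + d\<^sup>2) \<le> 1 + d\<^sup>2"
      by (rule real_le_lsqrt) (simp_all add: power2_sum)
    moreover have "(1 - d\<^sup>2) * (1 + d\<^sup>2) \<le> 1" by (simp add: algebra_simps)
    moreover have "0 \<le> 1 - d\<^sup>2" using d by (simp add: power_le_one)
    ultimately have "(1 - d\<^sup>2) * sqrt (1 + d\<^sup>2) \<le> 1"
      by (meson mult_left_mono order_trans)
    then have "1 - d\<^sup>2 \<le> 1 / sqrt (1 + d\<^sup>2)"
      using s1 by (subst pos_le_divide_eq) linarith+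
    then have "(u - h) * (1 - d\<^sup>2) \<le> w"
      unfolding w_def using u h mult_left_mono[of "1 - d\<^sup>2" "1 / sqrt (1 + d\<^sup>2)" "u - h"] by simp
    moreover have "(u - h) * (1 - d\<^sup>2) = u - h - (u - h) * d\<^sup>2"
      by (simp add: algebra_simps)
    moreover have "(u - h) * d\<^sup>2 \<le> t * d\<^sup>2"
      using u h by (intro mult_right_mono) auto
    moreover have "u = t - t * r" by (simp add: u_def algebra_simps)
    ultimately have "t - w \<le> t * r + h + t * d\<^sup>2" by linarith
    then have "t * (t - w) \<le> t * (t * r + h + t * d\<^sup>2)"
      using t by (intro mult_left_mono) auto
    then show "t * (t - w) \<le> y"
      by (simp add: y_def power2_eq_square algebra_simps)
  qed
  have y0: "0 \<le> y" using r h t by (simp add: y_def)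
  have t1: "1 - \<Phi> w \<le> (1 - \<Phi> t) * (1 + 27 * y * exp y)"
  proof -
    have "sqrt (1::real) \<le> sqrt (2 * pi)"
      using pi_gt3 by (intro real_sqrt_le_mono) simp
    then have p: "\<phi> w \<le> exp (- w\<^sup>2 / 2)"
      unfolding std_normal_density_def by (simp add: field_simps mult_left_le)
    have "t\<^sup>2 - w\<^sup>2 = (t - w) * (t + w)" by (simp add: power2_eq_square algebra_simps)
    also have "\<dots> \<le> (t - w) * (2 * t)" using w by (intro mult_left_mono) auto
    also have "\<dots> = 2 * (t * (t - w))" by simp
    also have "\<dots> \<le> 2 * y" using w by simp
    finally have "- w\<^sup>2 / 2 \<le> - t\<^sup>2 / 2 + y" by simp
    then have "exp (- w\<^sup>2 / 2) \<le> exp (- t\<^sup>2 / 2) * exp y"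
      by (simp only: exp_add[symmetric] exp_le_cancel_iff)
    also have "\<dots> \<le> (27 * t * (1 - \<Phi> t)) * exp y"
      using eT by (intro mult_right_mono) auto
    finally have p2: "\<phi> w \<le> (27 * t * (1 - \<Phi> t)) * exp y" using p by linarith
    have "\<Phi> t - \<Phi> w \<le> (t - w) * \<phi> w"
      using w by (intro std_normal_cdf_diff_le) auto
    also have "\<dots> \<le> (t - w) * ((27 * t * (1 - \<Phi> t)) * exp y)"
      using p2 w by (intro mult_left_mono) auto
    also have "\<dots> = (t * (t - w)) * (27 * (1 - \<Phi> t) * exp y)" by simp
    also have "\<dots> \<le> y * (27 * (1 - \<Phi> t) * exp y)"
      using w T0 by (intro mult_right_mono) auto
    finally show ?thesis by (simp add: algebra_simps)
  qed
  define E where "E = u * (h - u) + u\<^sup>2 * (1 + d\<^sup>2) / 2 + u * (B * b powr (1 - q)) + u ^ 3 * b"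
  \<comment> \<open>Since u * (h - u) + u^2 / 2 = u * h - u^2 / 2, the exponent is - u^2 / 2 plus
    small terms, and u^2 falls short of t^2 by at most 2 * t^2 * r.\<close>
  have E: "E \<le> - t\<^sup>2 / 2 + z"
  proof -
    have "u * h \<le> t * h" using u h by (intro mult_right_mono) auto
    moreover have "u\<^sup>2 * d\<^sup>2 \<le> t\<^sup>2 * d\<^sup>2" using u by (intro mult_right_mono power_mono) auto
    moreover have "0 \<le> t\<^sup>2 * d\<^sup>2" by simp
    moreover have "u * (B * b powr (1 - q)) \<le> t * b" using u Bb0 Bb1 t by (intro mult_mono) auto
    moreover have "u ^ 3 * b \<le> t ^ 3 * b" using u b by (intro mult_right_mono power_mono) auto
    moreover have "t\<^sup>2 - u\<^sup>2 \<le> 2 * (t\<^sup>2 * r)"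
    proof -
      have "t\<^sup>2 - u\<^sup>2 = 2 * (t\<^sup>2 * r) - (t * r)\<^sup>2"
        by (simp add: u_def power2_eq_square algebra_simps)
      then show ?thesis by simp
    qed
    moreover have "E = u * h - u\<^sup>2 / 2 + u\<^sup>2 * d\<^sup>2 / 2 + u * (B * b powr (1 - q)) + u ^ 3 * b"
      by (simp add: E_def power2_eq_square field_simps)
    ultimately show ?thesis unfolding z_def y_def by linarith
  qed
  have t2: "(2 * (B * b powr (1 - q)) + 2 * b) * (81000 * u ^ 3 / d ^ 4) * exp E
      \<le> (1 - \<Phi> t) * (8748000 * (t ^ 4 * b / d ^ 4) * exp z)"
  proof -
    have "exp E \<le> exp (- t\<^sup>2 / 2) * exp z"
      using E by (simp only: exp_add[symmetric] exp_le_cancel_iff)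
    also have "\<dots> \<le> (27 * t * (1 - \<Phi> t)) * exp z"
      using eT by (intro mult_right_mono) auto
    \<comment> \<open>By \<open>Bb1\<close> the accumulated error is at most 4 * b, and 4 * 81000 *
      27 = 8748000.\<close>
    finally have "(2 * (B * b powr (1 - q)) + 2 * b) * (81000 * u ^ 3 / d ^ 4) * exp E
        \<le> (4 * b) * (81000 * t ^ 3 / d ^ 4) * ((27 * t * (1 - \<Phi> t)) * exp z)"
      using Bb1 Bb0 b u d by (intro mult_mono divide_right_mono power_mono mult_left_mono) auto
    also have "\<dots> = (1 - \<Phi> t) * (8748000 * (t ^ 4 * b / d ^ 4) * exp z)"
      by (simp add: power4_eq_xxxx power3_eq_cube)
    finally show ?thesis .
  qed
  have "\<Phi> ((h - u) / sqrt (1 + d\<^sup>2)) = 1 - \<Phi> w"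
    using std_normal_cdf_minus[of w] by (simp add: w_def minus_divide_left)
  then have "\<Phi> (h / d) * measure (Pi\<^sub>M I (\<lambda>_. F)) {\<omega> \<in> space (Pi\<^sub>M I (\<lambda>_. F)). u \<le> (\<Sum>i\<in>I. a i * \<omega> i)}
    \<le> B * b powr - q + (1 - \<Phi> w)
      + (2 * (B * b powr (1 - q)) + 2 * b) * (81000 * u ^ 3 / d ^ 4) * exp E"
    using weighted_sum_tail[OF F q iq C(1) I a2 B ab b u(1) ub d, of h] by (simp add: E_def)
  also have "\<dots> \<le> B * b powr - q + (1 - \<Phi> t) * (1 + 27 * y * exp y)
      + (1 - \<Phi> t) * (8748000 * (t ^ 4 * b / d ^ 4) * exp z)"
    by (intro add_mono t1 t2 order_refl)
  also have "\<dots> = (1 - \<Phi> t) * (B * b powr - q / (1 - \<Phi> t) + 1 + 27 * y * exp y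
        + 8748000 * (t ^ 4 * b / d ^ 4) * exp z)"
  proof -
    have "B * b powr - q = (1 - \<Phi> t) * (B * b powr - q / (1 - \<Phi> t))"
      using T0 by simp
    then show ?thesis by (simp only: distrib_left)
  qed
  finally show ?thesis unfolding u_def .
qed

subsection \<open>Asymptotics\<close>

lemma normal_tail_pos: "0 < 1 - \<Phi> t"
proof -
  have "0 < exp (- (max t 1)\<^sup>2 / 2) / (27 * max t 1)" by simp
  also have "\<dots> \<le> 1 - \<Phi> (max t 1)" by (intro std_normal_tail_ge) simp
  also have "\<dots> \<le> 1 - \<Phi> t" using std_normal_cdf_mono[of t "max t 1"] by simp
  finally show ?thesis .
qed

lemma power_of_powr: "0 < x \<Longrightarrow> (x powr a) ^ k = x powr (a * real k)" for x :: real
  by (simp add: powr_realpow[symmetric] powr_powr)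

text \<open>The product is the k-th power of t n * n^(-c / k), and t <= 1 + t^2 bounds that base by
  a logarithm times a negative power of n.\<close>

lemma log_growth_negligible:
  fixes t :: "nat \<Rightarrow> real"
  assumes t: "\<forall>\<^sub>F n in sequentially. 0 \<le> t n \<and> (t n)\<^sup>2 \<le> L * ln (real n)" and c: "0 < c" and k: "0 < k"
  shows "(\<lambda>n. t n ^ k * real n powr - c) \<longlonglongrightarrow> 0"
proof -
  define e where "e = c / real k"
  have e: "0 < e" using c k by (simp add: e_def)
  have "(\<lambda>n. t n * real n powr - e) \<longlonglongrightarrow> 0"
  proof (rule tendsto_sandwich[OF _ _ tendsto_const])
    show "\<forall>\<^sub>F n in sequentially. 0 \<le> t n * real n powr - e"
      using t by eventually_elim auto
    show "\<forall>\<^sub>F n in sequentially. t n * real n powr - e \<le> (1 + L * ln (real n)) * real n powr - e"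
      using t
    proof eventually_elim
      case (elim n)
      have "t n \<le> 1 + (t n)\<^sup>2"
        using zero_le_power2[of "t n - 1"] elim by (simp add: power2_diff)
      then show ?case using elim by (intro mult_right_mono) auto
    qed
    show "(\<lambda>n. (1 + L * ln (real n)) * real n powr - e) \<longlonglongrightarrow> 0"
      using e by real_asymp
  qed
  then have "(\<lambda>n. (t n * real n powr - e) ^ k) \<longlonglongrightarrow> 0 ^ k"
    by (rule tendsto_power)
  moreover have "\<forall>\<^sub>F n in sequentially. (t n * real n powr - e) ^ k = t n ^ k * real n powr - c"
    using eventually_gt_at_top[of 0]
  proof eventually_elim
    case (elim n)
    then show ?case
      using k by (simp add: power_mult_distrib power_of_powr e_def)
  qed
  ultimately show ?thesis
    using k by (simp add: tendsto_cong zero_power)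
qed

text \<open>The tail level \<alpha> / (2 * p) is at most 1 / p, and so eventually below 1 - \<Phi>
  K, which is positive.\<close>

lemma std_normal_quantile_gt:
  fixes p :: "nat \<Rightarrow> nat" and \<alpha> :: "nat \<Rightarrow> real"
  assumes \<alpha>: "\<And>n. 1 \<le> n \<Longrightarrow> 0 < \<alpha> n \<and> \<alpha> n < 1" and p1: "\<And>n. 1 \<le> n \<Longrightarrow> 1 \<le> p n"
    and p: "filterlim p at_top sequentially"
  shows "\<forall>\<^sub>F n in sequentially. K < std_normal_quantile (1 - \<alpha> n / (2 * real (p n)))"
proof -
  have "filterlim (\<lambda>n. real (p n)) at_top sequentially"
    by (rule filterlim_compose[OF filterlim_real_sequentially p])
  then have "\<forall>\<^sub>F n in sequentially. 1 / (1 - \<Phi> K) < real (p n)"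
    by (rule filterlim_at_top_dense[THEN iffD1, rule_format])
  then show ?thesis
    using eventually_ge_at_top[of 1]
  proof eventually_elim
    case (elim n)
    note n = \<alpha>[OF elim(2)] p1[OF elim(2)]
    have "1 / real (p n) < 1 - \<Phi> K"
      using elim normal_tail_pos[of K] n by (simp add: field_simps)
    moreover have "\<alpha> n / (2 * real (p n)) \<le> 1 / real (p n)"
      using n by (simp add: field_simps)
    moreover have "0 < \<alpha> n / (2 * real (p n))" "\<alpha> n / (2 * real (p n)) < 1"
      using n by (auto simp: field_simps)
    ultimately have "\<Phi> K < \<Phi> (std_normal_quantile (1 - \<alpha> n / (2 * real (p n))))"
      by (subst std_normal_cdf_quantile) auto
    then show ?case by (rule std_normal_cdf_less_imp)
  qed
qed

text \<open>Stated for a sequence of laws so that it serves twice: for the true law with arbitrary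
  \<open>e\<close>, and for the maximizing laws with \<alpha> / 2 and e = 1. The bound of
  \<open>moderate_deviation\<close> is summed over 2 * p one-sided sums, each with Gaussian tail
  \<alpha> / (2 * p).\<close>

lemma asymptotic_tail_bound:
  fixes p :: "nat \<Rightarrow> nat" and \<alpha> :: "nat \<Rightarrow> real" and q C \<eta> e :: real
  assumes q: "2 < q" and C: "1 \<le> C" and \<eta>: "0 < \<eta>" "\<eta> < 1"
    and design: "\<And>n. 1 \<le> n \<Longrightarrow> normalized_design n (p n) (x n)"
    and law: "\<And>n. 1 \<le> n \<Longrightarrow> standardized_law (F n)"
    and Fq: "\<And>n. 1 \<le> n \<Longrightarrow> integrable (F n) (\<lambda>t. \<bar>t\<bar> powr q)"
      "\<And>n. 1 \<le> n \<Longrightarrow> integral\<^sup>L (F n) (\<lambda>t. \<bar>t\<bar> powr q) \<le> C"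
    and xq: "\<And>n j. 1 \<le> n \<Longrightarrow> j \<in> {1..p n} \<Longrightarrow> empirical_mean n (\<lambda>i. \<bar>x n i j\<bar> powr q) \<le> C"
    and \<alpha>: "\<And>n. 1 \<le> n \<Longrightarrow> 0 < \<alpha> n \<and> \<alpha> n < 1"
    and p: "filterlim p at_top sequentially"
    and rate: "\<forall>\<^sub>F n in sequentially. real (p n) \<le> \<alpha> n * real n powr (\<eta> * (q - 2) / 2) / 2"
    and e: "0 < e"
  shows "\<forall>\<^sub>F n in sequentially.
    1 - cdf (score_law n (p n) (x n) (F n)) (asymptotic_quantile n (p n) (\<alpha> n)) \<le> \<alpha> n * (1 + e)"
proof -
  \<comment> \<open>The exponents share out the slack (q - 2) / 2 = L + 2 * \<beta>. The rate gives
    a tail level of at least n^(-L). With b = n^(-\<kappa>) and \<kappa> * q = \<beta>, the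
    truncation cost B * b^(-q) is of order n^(-\<beta> - L), small even relative to that level.
    \<tau> = \<kappa> / 8 leaves b / d^4 = n^(-\<kappa> / 2). For the second moment,
    \<open>a\<close> is the exponent that q moments allow in \<open>sum_squares_lower_tail\<close>,
    and \<rho> makes its remainder a small fraction of the main term.\<close>
  define L where "L = \<eta> * (q - 2) / 2"
  define \<kappa> where "\<kappa> = (1 - \<eta>) * (q - 2) / (4 * q)"
  define \<tau> where "\<tau> = \<kappa> / 8"
  define a where "a = min (q / 2) 2"
  define \<rho> where "\<rho> = (a - 1) / 4"
  define \<beta> where "\<beta> = (1 - \<eta>) * (q - 2) / 4"
  have L: "0 < L" using \<eta> q by (simp add: L_def)
  have \<kappa>: "0 < \<kappa>" using \<eta> q by (simp add: \<kappa>_def)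
  have \<tau>: "0 < \<tau>" using \<kappa> by (simp add: \<tau>_def)
  have a: "1 < a" "a \<le> 2" "2 * a \<le> q" using q by (auto simp: a_def)
  have \<rho>: "0 < \<rho>" "\<rho> \<le> 1 / 4" using a by (auto simp: \<rho>_def)
  have \<beta>: "0 < \<beta>" using \<eta> q by (simp add: \<beta>_def)
  have \<kappa>q: "\<kappa> * q = \<beta>" using q by (simp add: \<kappa>_def \<beta>_def)
  have \<beta>L: "- (q - 2) / 2 + \<beta> = - \<beta> - L" by (simp add: \<beta>_def L_def field_simps)
  define \<pi>' where "\<pi>' = (\<lambda>n. \<alpha> n / (2 * real (p n)))"
  define t where "t = (\<lambda>n. std_normal_quantile (1 - \<pi>' n))"
  have p1: "1 \<le> p n" if "1 \<le> n" for n
    using design[OF that] by (simp add: normalized_design_def)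
  have \<pi>: "0 < \<pi>' n" "\<pi>' n < 1" "\<pi>' n \<le> 1 / (2 * real (p n))" if "1 \<le> n" for n
    using \<alpha>[OF that] p1[OF that] by (auto simp: \<pi>'_def divide_simps)
  have \<Phi>t: "1 - \<Phi> (t n) = \<pi>' n" if "1 \<le> n" for n
    unfolding t_def using \<pi>[OF that] by (subst std_normal_cdf_quantile) auto
  have ev1: "\<forall>\<^sub>F n in sequentially. 1 \<le> n" by (rule eventually_ge_at_top)
  have t_gt: "\<forall>\<^sub>F n in sequentially. K < t n" for K
    unfolding t_def \<pi>'_def using \<alpha> p1 p by (rule std_normal_quantile_gt)
  have \<pi>L: "\<forall>\<^sub>F n in sequentially. real n powr - L \<le> \<pi>' n"
    using rate ev1
  proof eventually_elim
    case (elim n)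
    then have "2 * real (p n) \<le> \<alpha> n * real n powr L" by (simp add: L_def)
    then show ?case
      using elim p1[of n] by (simp add: \<pi>'_def powr_minus field_simps)
  qed
  \<comment> \<open>From n^(-L) <= \<open>\<pi>' n\<close> <= exp (- t^2 / 2): the level t grows at
    most like the root of ln n, so its powers are negligible against those of n.\<close>
  have tL: "\<forall>\<^sub>F n in sequentially. 0 \<le> t n \<and> (t n)\<^sup>2 \<le> (2 * L) * ln (real n)"
    using \<pi>L ev1 t_gt[of 0]
  proof eventually_elim
    case (elim n)
    have "real n powr - L \<le> exp (- (t n)\<^sup>2 / 2)"
      using std_normal_tail_le[of "t n"] elim \<Phi>t[of n] by (smt (verit) exp_gt_zero field_sum_of_halves)
    then have "exp (- L * ln (real n)) \<le> exp (- (t n)\<^sup>2 / 2)"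
      using elim by (simp add: powr_def)
    then show ?case using elim by simp
  qed
  note small = log_growth_negligible[OF tL]
  define b where "b = (\<lambda>n. real n powr - \<kappa>)"
  define d where "d = (\<lambda>n. real n powr - \<tau>)"
  \<comment> \<open>The shift h sits between d and 1: t * h still tends to 0, while h / d =
    n^(\<tau> / 2) tends to infinity and \<Phi> (h / d) to 1.\<close>
  define h where "h = (\<lambda>n. real n powr - (\<tau> / 2))"
  define r where "r = (\<lambda>n. real n powr - \<rho>)"
  define B where "B = (\<lambda>n. C\<^sup>2 * real n powr (- (q - 2) / 2))"
  define y where "y = (\<lambda>n. (t n)\<^sup>2 * r n + t n * h n + (t n)\<^sup>2 * (d n)\<^sup>2)"
  define z where "z = (\<lambda>n. y n + t n * b n + t n ^ 3 * b n)"
  \<comment> \<open>\<open>G\<close> is the factor by which a one-sided tail may exceed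
    \<open>\<pi>'\<close>; \<open>low\<close> is the cost of a small empirical second moment
    relative to \<alpha>, by \<alpha> >= n^(-L).\<close>
  define G where "G = (\<lambda>n. (C\<^sup>2 * real n powr - \<beta> + 1 + 27 * y n * exp (y n)
      + 8748000 * (t n ^ 4 * real n powr - (\<kappa> / 2)) * exp (z n)) / \<Phi> (real n powr (\<tau> / 2)))"
  define low where "low = (\<lambda>n. real n powr L * exp (- (real n powr (1 / 4)) / 2))"
  have d2: "(d n)\<^sup>2 = real n powr - (2 * \<tau>)" for n
    by (cases "n = 0") (simp_all add: d_def power_of_powr mult.commute)
  have y_lim: "y \<longlonglongrightarrow> 0"
    unfolding y_def r_def h_def d2
    using tendsto_add[OF tendsto_add[OF small[of \<rho> 2] small[of "\<tau> / 2" 1]] small[of "2 * \<tau>" 2]] \<rho> \<tau> by simp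
  have z_lim: "z \<longlonglongrightarrow> 0"
    unfolding z_def b_def using tendsto_add[OF tendsto_add[OF y_lim small[of \<kappa> 1]] small[of \<kappa> 3]] \<kappa> by simp
  have \<Phi>lim: "(\<lambda>n. \<Phi> (real n powr (\<tau> / 2))) \<longlonglongrightarrow> 1"
    by (rule filterlim_compose[OF std_normal_cdf_at_top]) (use \<tau> in real_asymp)
  have "G \<longlonglongrightarrow> (C\<^sup>2 * 0 + 1 + 27 * 0 * exp 0 + 8748000 * 0 * exp 0) / 1"
    unfolding G_def
  proof (intro tendsto_intros y_lim z_lim \<Phi>lim)
    show "(\<lambda>n. real n powr - \<beta>) \<longlonglongrightarrow> 0" using \<beta> by real_asymp
    show "(\<lambda>n. t n ^ 4 * real n powr - (\<kappa> / 2)) \<longlonglongrightarrow> 0" using \<kappa> by (intro small) auto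
  qed auto
  then have G_lim: "G \<longlonglongrightarrow> 1" by simp
  have low_lim: "low \<longlonglongrightarrow> 0"
    unfolding low_def using L by real_asymp
  have "(\<lambda>n. low n + G n) \<longlonglongrightarrow> 0 + 1"
    by (intro tendsto_add low_lim G_lim)
  then have final: "\<forall>\<^sub>F n in sequentially. low n + G n < 1 + e"
    using e by (intro order_tendstoD(2)) auto
  have ev_tb: "\<forall>\<^sub>F n in sequentially. t n * b n < 1"
    using order_tendstoD(2)[OF small[of \<kappa> 1], of 1] \<kappa> by (simp add: b_def)
  have ev_B: "\<forall>\<^sub>F n in sequentially. C\<^sup>2 * real n powr - \<beta> < 1"
  proof (rule order_tendstoD(2))
    show "(\<lambda>n. C\<^sup>2 * real n powr - \<beta>) \<longlonglongrightarrow> 0" using \<beta> by real_asymp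
  qed simp
  have ev_r: "\<forall>\<^sub>F n in sequentially. (1 + C) * r n < 1 / 2"
  proof (rule order_tendstoD(2))
    show "(\<lambda>n. (1 + C) * r n) \<longlonglongrightarrow> 0" unfolding r_def using \<rho> by real_asymp
  qed simp
  show ?thesis
    using ev1 final ev_tb ev_B ev_r t_gt[of 2] \<pi>L
  proof eventually_elim
    case (elim n)
    then have n: "1 \<le> n" by simp
    then have n1: "1 \<le> real n" and n0: "0 < real n" by auto
    note Fn = law[OF n] and iq = Fq(1)[OF n] and Cq = Fq(2)[OF n]
    let ?P = "\<Pi>\<^sub>M i\<in>{1..n}. F n"
    have le1: "real n powr - c \<le> 1" if "0 < c" for c
      using powr_mono[of "- c" 0 "real n"] n1 that by simp
    have r: "0 \<le> r n" "r n \<le> 1 / 2"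
    proof -
      show "0 \<le> r n" by (simp add: r_def)
      then have "1 * r n \<le> (1 + C) * r n" using C by (intro mult_right_mono) auto
      then show "r n \<le> 1 / 2" using elim by linarith
    qed
    have bn: "0 < b n" "b n \<le> 1" and dn: "0 < d n" "d n \<le> 1" and hn: "0 \<le> h n" "h n \<le> 1"
      using n0 \<kappa> \<tau> le1 by (auto simp: b_def d_def h_def)
    have bq: "b n powr - q = real n powr \<beta>"
      by (simp add: b_def powr_powr \<kappa>q)
    have Bbq: "B n * b n powr - q = C\<^sup>2 * real n powr - \<beta> * real n powr - L"
    proof -
      have "B n * b n powr - q = C\<^sup>2 * real n powr (- (q - 2) / 2 + \<beta>)"
        unfolding bq B_def by (simp add: powr_add)
      also have "\<dots> = C\<^sup>2 * real n powr - \<beta> * real n powr - L"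
        unfolding \<beta>L by (simp add: powr_add[symmetric])
      finally show ?thesis .
    qed
    have Bb: "B n * b n powr - q \<le> 1"
    proof -
      have "B n * b n powr - q \<le> C\<^sup>2 * real n powr - \<beta> * 1"
        unfolding Bbq using le1[OF L] by (intro mult_left_mono) auto
      then show ?thesis using elim by linarith
    qed
    have B\<pi>: "B n * b n powr - q / \<pi>' n \<le> C\<^sup>2 * real n powr - \<beta>"
    proof -
      have "B n * b n powr - q \<le> C\<^sup>2 * real n powr - \<beta> * \<pi>' n"
        unfolding Bbq using elim by (intro mult_left_mono) auto
      then show ?thesis using \<pi>(1)[OF n] by (simp add: pos_divide_le_eq)
    qed
    have hd: "h n / d n = real n powr (\<tau> / 2)"
      by (simp add: h_def d_def powr_diff[symmetric])
    have bd: "b n / d n ^ 4 = real n powr - (\<kappa> / 2)"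
      using n0 by (simp add: b_def d_def power_of_powr powr_diff[symmetric] \<tau>_def)
    have \<Phi>0: "0 < \<Phi> (h n / d n)"
      using std_normal_cdf_mono[of 0 "h n / d n"] hn dn by (simp add: std_normal_cdf_zero)
    \<comment> \<open>Only the absolute values of the weights are prescribed, so both signs of a
      design column are covered.\<close>
    have one: "measure ?P {\<omega> \<in> space ?P. t n * (1 - r n) \<le> (\<Sum>i=1..n. w i * \<omega> i)} \<le> \<pi>' n * G n"
      if w: "\<And>i. \<bar>w i\<bar> = \<bar>x n i j\<bar> / sqrt (real n)" and j: "j \<in> {1..p n}" for w j
    proof -
      have w2: "(\<Sum>i=1..n. (w i)\<^sup>2) = 1"
      proof -
        have "(w i)\<^sup>2 = (x n i j)\<^sup>2 / real n" for i
          using arg_cong[OF w[of i], of "\<lambda>v. v\<^sup>2"] n0 by (simp add: power_divide)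
        then show ?thesis
          using design[OF n] j by (simp add: normalized_design_def empirical_mean_def sum_divide_distrib)
      qed
      \<comment> \<open>Scaling by 1 / sqrt n gives n^(-q / 2) times n times an empirical mean,
        hence the power - (q - 2) / 2; one factor C comes from the law and one from the
        design.\<close>
      have wq: "C * (\<Sum>i\<in>{1..n}. \<bar>w i\<bar> powr q) \<le> B n"
      proof -
        have "\<bar>w i\<bar> powr q = \<bar>x n i j\<bar> powr q * real n powr - (q / 2)" for i
          unfolding w using n0 by (simp add: powr_divide powr_half_sqrt[symmetric] powr_powr powr_minus divide_simps)
        then have "(\<Sum>i=1..n. \<bar>w i\<bar> powr q) = (\<Sum>i=1..n. \<bar>x n i j\<bar> powr q) * real n powr - (q / 2)"
          by (simp add: sum_distrib_right)
        also have "\<dots> = empirical_mean n (\<lambda>i. \<bar>x n i j\<bar> powr q) * real n powr (- (q - 2) / 2)"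
        proof -
          have "real n powr (- (q - 2) / 2) = real n powr (1 + - (q / 2))"
            by (simp add: field_simps)
          also have "\<dots> = real n * real n powr - (q / 2)"
            using n0 by (simp only: powr_add powr_one)
          finally show ?thesis using n0 by (simp add: empirical_mean_def)
        qed
        also have "\<dots> \<le> C * real n powr (- (q - 2) / 2)"
          using xq[OF n j] by (intro mult_right_mono) auto
        finally have "C * (\<Sum>i=1..n. \<bar>w i\<bar> powr q) \<le> C * (C * real n powr (- (q - 2) / 2))"
          using C by (intro mult_left_mono) auto
        then show ?thesis by (simp add: B_def power2_eq_square mult.assoc)
      qed
      have "\<Phi> (h n / d n) * measure ?P {\<omega> \<in> space ?P. t n * (1 - r n) \<le> (\<Sum>i=1..n. w i * \<omega> i)}
        \<le> (1 - \<Phi> (t n)) * (B n * b n powr - q / (1 - \<Phi> (t n)) + 1 + 27 * y n * exp (y n)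
          + 8748000 * (t n ^ 4 * b n / d n ^ 4) * exp (z n))"
        unfolding z_def y_def
        using elim(3,6) by (intro moderate_deviation[OF Fn q iq Cq C finite_atLeastAtMost w2 wq bn Bb _ _ dn hn r]) auto
      also have "\<dots> \<le> \<pi>' n * (C\<^sup>2 * real n powr - \<beta> + 1 + 27 * y n * exp (y n)
          + 8748000 * (t n ^ 4 * real n powr - (\<kappa> / 2)) * exp (z n))"
        unfolding \<Phi>t[OF n] times_divide_eq_right[symmetric] bd using \<pi>[OF n] B\<pi> by (intro mult_left_mono) auto
      also have "\<dots> = \<Phi> (h n / d n) * (\<pi>' n * G n)"
        using \<Phi>0 by (simp add: G_def hd)
      finally show ?thesis
        using \<Phi>0 by (simp only: mult_le_cancel_left_pos)
    qed
    have low: "measure ?P {\<omega> \<in> space ?P. (\<Sum>i=1..n. (\<omega> i)\<^sup>2) \<le> real n * (1 - r n)} \<le> \<alpha> n * low n"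
    proof -
      \<comment> \<open>With g = n^(-1/2) the choice of \<rho> gives g^a = g * r^2, so the remainder
        is at most half the main term once (1 + C) * r < 1/2, and n * g * r = n^(1/2 - \<rho>) >=
        n^(1/4).\<close>
      define g where "g = real n powr - (1 / 2)"
      have "measure ?P {\<omega> \<in> space ?P. (\<Sum>i=1..n. (\<omega> i)\<^sup>2) \<le> real n * (1 - r n)}
        \<le> exp (- real n * (g * r n - (1 + C) * g powr a))"
        using sum_squares_lower_tail[OF Fn q iq Cq, of "{1..n}" g a "r n"] a n0 by (simp add: g_def)
      also have "\<dots> \<le> exp (- (real n powr (1 / 4)) / 2)"
      proof -
        have ga: "g powr a = g * (r n * r n)"
          using n0 by (simp add: g_def r_def powr_powr powr_add[symmetric] \<rho>_def field_simps)
        have "g * r n - (1 + C) * g powr a = g * r n * (1 - (1 + C) * r n)"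
          unfolding ga by (simp add: algebra_simps)
        also have "\<dots> \<ge> g * r n * (1 / 2)"
          using elim r by (intro mult_left_mono) (auto simp: g_def)
        finally have 1: "real n * (g * r n - (1 + C) * g powr a) \<ge> real n * (g * r n * (1 / 2))"
          by (intro mult_left_mono) auto
        have "real n * (g * r n) = real n powr (1 + (- (1 / 2) + - \<rho>))"
          using n0 by (simp only: g_def r_def powr_add powr_one)
        also have "\<dots> \<ge> real n powr (1 / 4)"
          using n1 \<rho> by (intro powr_mono) auto
        finally show ?thesis using 1 by simp
      qed
      also have "\<dots> = (real n powr - L * real n powr L) * exp (- (real n powr (1 / 4)) / 2)"
        using n0 by (simp add: powr_add[symmetric])
      also have "\<dots> \<le> (\<alpha> n * real n powr L) * exp (- (real n powr (1 / 4)) / 2)"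
      proof (intro mult_right_mono)
        have "\<pi>' n \<le> \<alpha> n"
          using \<alpha>[OF n] p1[OF n] by (simp add: \<pi>'_def divide_le_eq)
        then show "real n powr - L \<le> \<alpha> n" using elim by linarith
      qed auto
      finally show ?thesis by (simp add: low_def mult.assoc)
    qed
    have "1 - cdf (score_law n (p n) (x n) (F n)) (asymptotic_quantile n (p n) (\<alpha> n))
      \<le> \<alpha> n * low n + (\<Sum>j=1..p n. \<pi>' n * G n + \<pi>' n * G n)"
      unfolding asymptotic_quantile_def \<pi>'_def[symmetric, THEN fun_cong] t_def[symmetric, THEN fun_cong]
    proof (rule order_trans[OF score_stat_union_bound[OF Fn n p1[OF n], of "t n" "r n"] add_mono[OF low sum_mono[OF add_mono]]])
      show "0 \<le> t n" "0 \<le> r n" "r n \<le> 1" using elim r by auto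
      fix j assume j: "j \<in> {1..p n}"
      show "measure ?P {\<omega> \<in> space ?P. t n * (1 - r n) \<le> (\<Sum>i=1..n. x n i j / sqrt (real n) * \<omega> i)} \<le> \<pi>' n * G n"
        by (rule one[OF _ j]) simp
      show "measure ?P {\<omega> \<in> space ?P. t n * (1 - r n) \<le> (\<Sum>i=1..n. - (x n i j / sqrt (real n)) * \<omega> i)} \<le> \<pi>' n * G n"
        by (rule one[OF _ j]) simp
    qed
    also have "\<dots> = \<alpha> n * (low n + G n)"
      using p1[OF n] by (simp add: \<pi>'_def field_simps)
    also have "\<dots> \<le> \<alpha> n * (1 + e)"
      using elim \<alpha>[OF n] by (intro mult_left_mono) auto
    finally show ?case .
  qed
qed

section \<open>Uniform moment bounds and the size of the Gaussian quantile\<close>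

lemma nn_integral_bound_imp_integral:
  fixes f :: "real \<Rightarrow> real"
  assumes "f \<in> borel_measurable F" "\<And>t. 0 \<le> f t" "(\<integral>\<^sup>+ t. ennreal (f t) \<partial>F) \<le> ennreal C" "0 \<le> C"
  shows "integrable F f" "integral\<^sup>L F f \<le> C"
proof -
  show i: "integrable F f"
    using assms by (intro integrableI_nonneg) (auto intro: le_less_trans)
  have "ennreal (integral\<^sup>L F f) = (\<integral>\<^sup>+ t. ennreal (f t) \<partial>F)"
    using assms i by (intro nn_integral_eq_integral[symmetric]) auto
  then show "integral\<^sup>L F f \<le> C"
    using assms(3,4) by (metis ennreal_le_iff)
qed

lemma ennreal_finite_ex: "x < \<infinity> \<Longrightarrow> \<exists>C\<ge>0. x = ennreal C"
  by (cases x) auto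

text \<open>A finite supremum of extended moments yields integrability and a bound at once. One
  constant serves laws and design, and C >= 1 is what \<open>moderate_deviation\<close> asks
  for.\<close>

lemma moment_condition_uniform_bound:
  assumes M: "moment_condition q p x F\<^sub>0 \<F>"
    and law: "\<And>n F. 1 \<le> n \<Longrightarrow> F \<in> \<F> n \<Longrightarrow> standardized_law F"
  shows "\<exists>C\<ge>1. (\<forall>n\<ge>1. \<forall>F\<in>\<F> n. integrable F (\<lambda>t. \<bar>t\<bar> powr q) \<and> integral\<^sup>L F (\<lambda>t. \<bar>t\<bar> powr q) \<le> C)
    \<and> (\<forall>n\<ge>1. \<forall>j\<in>{1..p n}. empirical_mean n (\<lambda>i. \<bar>x n i j\<bar> powr q) \<le> C)"
proof -
  have fin: "(SUP n\<in>{1..}. SUP F\<in>\<F> n. \<integral>\<^sup>+ t. ennreal (\<bar>t\<bar> powr q) \<partial>F) < \<infinity>"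
    "(SUP n\<in>{1..}. SUP j\<in>{1..p n}. ennreal (empirical_mean n (\<lambda>i. \<bar>x n i j\<bar> powr q))) < \<infinity>"
    using M unfolding moment_condition_def by blast+
  obtain C1 where C1: "0 \<le> C1"
    "(SUP n\<in>{1..}. SUP F\<in>\<F> n. \<integral>\<^sup>+ t. ennreal (\<bar>t\<bar> powr q) \<partial>F) = ennreal C1"
    using ennreal_finite_ex[OF fin(1)] by blast
  obtain C2 where C2: "0 \<le> C2"
    "(SUP n\<in>{1..}. SUP j\<in>{1..p n}. ennreal (empirical_mean n (\<lambda>i. \<bar>x n i j\<bar> powr q))) = ennreal C2"
    using ennreal_finite_ex[OF fin(2)] by blast
  have 1: "integrable F (\<lambda>t. \<bar>t\<bar> powr q)" "integral\<^sup>L F (\<lambda>t. \<bar>t\<bar> powr q) \<le> C1"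
    if "1 \<le> n" "F \<in> \<F> n" for n F
  proof -
    note [measurable_cong] = standardized_lawD(2)[OF law[OF that]]
    have "(\<integral>\<^sup>+ t. ennreal (\<bar>t\<bar> powr q) \<partial>F) \<le> ennreal C1"
      unfolding C1(2)[symmetric] using that by (intro SUP_upper2[of n] SUP_upper2[of F]) auto
    then show "integrable F (\<lambda>t. \<bar>t\<bar> powr q)" "integral\<^sup>L F (\<lambda>t. \<bar>t\<bar> powr q) \<le> C1"
      using C1(1) nn_integral_bound_imp_integral[of "\<lambda>t. \<bar>t\<bar> powr q" F C1] by auto
  qed
  have 2: "empirical_mean n (\<lambda>i. \<bar>x n i j\<bar> powr q) \<le> C2" if "1 \<le> n" "j \<in> {1..p n}" for n j
  proof -
    have "ennreal (empirical_mean n (\<lambda>i. \<bar>x n i j\<bar> powr q)) \<le> ennreal C2"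
      unfolding C2(2)[symmetric] using that by (intro SUP_upper2[of n] SUP_upper2[of j]) auto
    then show ?thesis using C2(1) by simp
  qed
  show ?thesis
    by (intro exI[of _ "max 1 (max C1 C2)"]) (use 1 2 in \<open>auto simp: le_max_iff_disj\<close>)
qed

text \<open>The tail bound \<alpha> / (2 * p) <= exp (- t^2 / 2) solved for t. Since \<alpha> / (2 *
  p) < 1/2, the level lies above the median, whence positivity.\<close>

lemma asymptotic_quantile_bounds:
  assumes "1 \<le> n" "1 \<le> p" "0 < \<alpha>" "\<alpha> < 1"
  shows "0 < asymptotic_quantile n p \<alpha>"
    and "asymptotic_quantile n p \<alpha> \<le> sqrt (2 * real n * ln (2 * real p / \<alpha>))"
proof -
  define u where "u = \<alpha> / (2 * real p)"
  define t where "t = std_normal_quantile (1 - u)"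
  have u: "0 < u" "u < 1 / 2"
    using assms by (auto simp: u_def field_simps)
  have \<Phi>t: "\<Phi> t = 1 - u"
    unfolding t_def using u by (intro std_normal_cdf_quantile) auto
  have "\<Phi> 0 < \<Phi> t" using u by (simp add: \<Phi>t std_normal_cdf_zero)
  then have t: "0 < t" by (rule std_normal_cdf_less_imp)
  have a: "asymptotic_quantile n p \<alpha> = sqrt (real n) * t"
    by (simp add: asymptotic_quantile_def t_def u_def)
  show "0 < asymptotic_quantile n p \<alpha>"
    unfolding a using t assms by simp
  have "u \<le> exp (- t\<^sup>2 / 2) / 2"
    using std_normal_tail_le[of t] t \<Phi>t by simp
  also have "\<dots> \<le> exp (- t\<^sup>2 / 2)" by simp
  finally have "ln u \<le> - t\<^sup>2 / 2"
    using u by (simp add: ln_ge_iff[symmetric] ln_le_cancel_iff[symmetric])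
  moreover have "ln (2 * real p / \<alpha>) = - ln u"
    using assms by (simp add: u_def ln_div)
  ultimately have "t\<^sup>2 \<le> 2 * ln (2 * real p / \<alpha>)" by simp
  then have "t \<le> sqrt (2 * ln (2 * real p / \<alpha>))"
    by (rule real_le_rsqrt)
  then have "sqrt (real n) * t \<le> sqrt (real n) * sqrt (2 * ln (2 * real p / \<alpha>))"
    by (intro mult_left_mono) auto
  also have "\<dots> = sqrt (2 * real n * ln (2 * real p / \<alpha>))"
    by (simp add: real_sqrt_mult[symmetric] mult_ac)
  finally show "asymptotic_quantile n p \<alpha> \<le> sqrt (2 * real n * ln (2 * real p / \<alpha>))"
    unfolding a .
qed

text \<open>By \<open>std_normal_tail_shift\<close>, moving from t to t * (1 + c) multiplies the
  tail by at most exp (- c * t^2), which is below 1/2 once c * t^2 > 2. As t tends to infinity,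
  halving the tail level moves the quantile by a vanishing relative amount.\<close>

lemma asymptotic_quantile_half:
  fixes p :: "nat \<Rightarrow> nat" and \<alpha> :: "nat \<Rightarrow> real"
  assumes \<alpha>: "\<And>n. 1 \<le> n \<Longrightarrow> 0 < \<alpha> n \<and> \<alpha> n < 1" and p1: "\<And>n. 1 \<le> n \<Longrightarrow> 1 \<le> p n"
    and p: "filterlim p at_top sequentially" and c: "0 < c"
  shows "\<forall>\<^sub>F n in sequentially.
    asymptotic_quantile n (p n) (\<alpha> n / 2) \<le> asymptotic_quantile n (p n) (\<alpha> n) * (1 + c)"
proof -
  have "\<forall>\<^sub>F n in sequentially. max 1 (2 / c) < std_normal_quantile (1 - \<alpha> n / (2 * real (p n)))"
    using \<alpha> p1 p by (rule std_normal_quantile_gt)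
  then show ?thesis
    using eventually_ge_at_top[of 1]
  proof eventually_elim
    case (elim n)
    define u where "u = \<alpha> n / (2 * real (p n))"
    define t where "t = std_normal_quantile (1 - u)"
    define t' where "t' = std_normal_quantile (1 - u / 2)"
    have u: "0 < u" "u < 1 / 2"
      using \<alpha>[OF elim(2)] p1[OF elim(2)] by (auto simp: u_def field_simps)
    have \<Phi>t: "\<Phi> t = 1 - u" and \<Phi>t': "\<Phi> t' = 1 - u / 2"
      unfolding t_def t'_def using u by (auto intro!: std_normal_cdf_quantile)
    have t: "1 < t" "2 / c < t" using elim by (auto simp: t_def u_def)
    have "2 < c * t" using t c by (simp add: field_simps)
    also have "\<dots> \<le> c * t * t" using t c by simp
    finally have ct: "2 < c * t * t" .
    have "1 - \<Phi> (t + c * t) \<le> exp (- (c * t) * t - (c * t)\<^sup>2 / 2) * (1 - \<Phi> t)"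
      using t c by (intro std_normal_tail_shift) auto
    also have "\<dots> \<le> exp (- 2) * u"
    proof -
      have "- (c * t) * t - (c * t)\<^sup>2 / 2 \<le> - 2"
        using ct zero_le_power2[of "c * t"] unfolding mult_minus_left by linarith
      then show ?thesis
        using u unfolding \<Phi>t by simp
    qed
    also have "exp (- 2) < (1 / 2 :: real)"
      using exp_ge_add_one_self[of "2::real"] by (simp add: exp_minus field_simps)
    then have "exp (- 2) * u < u / 2" using u by simp
    finally have "\<Phi> t' < \<Phi> (t + c * t)" using \<Phi>t' by simp
    then have "t' \<le> t * (1 + c)"
      using std_normal_cdf_less_imp by (fastforce simp: algebra_simps)
    then have "sqrt (real n) * t' \<le> sqrt (real n) * (t * (1 + c))"
      by (intro mult_left_mono) auto
    then show ?case
      by (simp add: asymptotic_quantile_def t'_def t_def u_def mult_ac)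
  qed
qed

theorem lemma2:
  fixes c :: real
  assumes "c > 1"
  shows
    "(\<forall>(M :: 'a measure) n p x \<epsilon> F\<^sub>0 \<alpha>.
        regression_model M n p x \<epsilon> F\<^sub>0 \<and> 0 < \<alpha> \<and> \<alpha> < 1 \<longrightarrow>
        (\<forall>F. F\<^sub>0 = F \<longrightarrow>
          \<P>(\<omega> in M. c * score_quantile n p x F (1 - \<alpha>)
                        \<ge> c * score_stat n p x (\<lambda>i. \<epsilon> i \<omega>)) \<ge> 1 - \<alpha>) \<and>
        (\<forall>\<F>. law_family n p x \<F> (1 - \<alpha>) \<and>
          (F\<^sub>0 \<in> \<F> \<or>
            (\<exists>F\<in>\<F>. score_quantile n p x F (1 - \<alpha>) \<ge> score_quantile n p x F\<^sub>0 (1 - \<alpha>))) \<longrightarrow>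
          \<P>(\<omega> in M. c * max_score_quantile n p x \<F> (1 - \<alpha>)
                        \<ge> c * score_stat n p x (\<lambda>i. \<epsilon> i \<omega>)) \<ge> 1 - \<alpha>)) \<and>
     (\<forall>(M :: nat \<Rightarrow> 'a measure) p x \<epsilon> F\<^sub>0 \<F> \<alpha> q.
        (\<forall>n\<ge>1. regression_model (M n) n (p n) (x n) (\<epsilon> n) (F\<^sub>0 n)) \<and>
        (\<forall>n\<ge>1. 0 < \<alpha> n \<and> \<alpha> n < 1) \<and>
        (\<exists>a<1. \<forall>n\<ge>1. \<alpha> n \<le> a) \<and>
        (\<forall>n\<ge>1. law_family n (p n) (x n) (\<F> n) (1 - \<alpha> n)) \<and>
        filterlim p at_top sequentially \<and>
        moment_condition q p x F\<^sub>0 \<F> \<and>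
        rate_condition q p \<alpha> \<longrightarrow>
        (\<exists>r. r \<in> o(\<alpha>) \<and>
          (\<forall>n\<ge>1. \<P>(\<omega> in M n. c * asymptotic_quantile n (p n) (\<alpha> n)
                        \<ge> c * score_stat n (p n) (x n) (\<lambda>i. \<epsilon> n i \<omega>)) \<ge> 1 - \<alpha> n - r n)) \<and>
        (\<exists>r s. r \<in> o(\<lambda>_. 1) \<and> s \<in> o(\<lambda>_. 1) \<and>
          (\<forall>n\<ge>1.
            max_score_quantile n (p n) (x n) (\<F> n) (1 - \<alpha> n)
              \<le> asymptotic_quantile n (p n) (\<alpha> n) * (1 + r n) \<and>
            asymptotic_quantile n (p n) (\<alpha> n) * (1 + r n)
              \<le> sqrt (2 * real n * ln (2 * real (p n) / \<alpha> n)) * (1 + s n))))"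
    (is "?finite_sample \<and> ?asymptotic")
proof
  have c: "0 < c" using assms by simp

  \<comment> \<open>Finite-sample coverage of the exact and semi-exact options\<close>
  show ?finite_sample
  proof (intro allI impI conjI)
    fix M :: "'a measure" and n p x \<epsilon> F\<^sub>0 and \<alpha> :: real
    assume R: "regression_model M n p x \<epsilon> F\<^sub>0 \<and> 0 < \<alpha> \<and> \<alpha> < 1"
    then have F: "standardized_law F\<^sub>0" "1 \<le> p" "0 < 1 - \<alpha>" "1 - \<alpha> < 1"
      by (auto simp: regression_model_def normalized_design_def)
    \<comment> \<open>Any level at or above the quantile of the true law has the required coverage;
      both options provide such a level.\<close>
    have P: "1 - \<alpha> \<le> \<P>(\<omega> in M. c * l \<ge> c * score_stat n p x (\<lambda>i. \<epsilon> i \<omega>))"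
      if "score_quantile n p x F\<^sub>0 (1 - \<alpha>) \<le> l" for l
      using regression_model_prob[of M n p x \<epsilon> F\<^sub>0 c l] R c cdf_score_quantile_ge[OF F that] by simp
    show "1 - \<alpha> \<le> \<P>(\<omega> in M. c * score_quantile n p x F (1 - \<alpha>) \<ge> c * score_stat n p x (\<lambda>i. \<epsilon> i \<omega>))"
      if "F\<^sub>0 = F" for F
      using that by (intro P) simp
    fix \<F>
    assume \<F>: "law_family n p x \<F> (1 - \<alpha>) \<and>
      (F\<^sub>0 \<in> \<F> \<or> (\<exists>F\<in>\<F>. score_quantile n p x F (1 - \<alpha>) \<ge> score_quantile n p x F\<^sub>0 (1 - \<alpha>)))"
    \<comment> \<open>If the true law belongs to the family it is its own witness, so the two
      alternatives merge.\<close>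
    then obtain F where "F \<in> \<F>" "score_quantile n p x F\<^sub>0 (1 - \<alpha>) \<le> score_quantile n p x F (1 - \<alpha>)"
      by blast
    moreover have "score_quantile n p x F (1 - \<alpha>) \<le> max_score_quantile n p x \<F> (1 - \<alpha>)"
      using \<F> \<open>F \<in> \<F>\<close> unfolding law_family_def by (elim conjE max_score_quantile_attained)
    ultimately show "1 - \<alpha> \<le> \<P>(\<omega> in M. c * max_score_quantile n p x \<F> (1 - \<alpha>)
        \<ge> c * score_stat n p x (\<lambda>i. \<epsilon> i \<omega>))"
      by (intro P) (rule order_trans)
  qed
  show ?asymptotic
  proof (intro allI impI, elim conjE, intro conjI)
    fix M :: "nat \<Rightarrow> 'a measure" and p x \<epsilon> F\<^sub>0 \<F> and \<alpha> :: "nat \<Rightarrow> real" and q :: real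
    assume R: "\<forall>n\<ge>1. regression_model (M n) n (p n) (x n) (\<epsilon> n) (F\<^sub>0 n)"
      and \<alpha>: "\<forall>n\<ge>1. 0 < \<alpha> n \<and> \<alpha> n < 1"
      and \<F>: "\<forall>n\<ge>1. law_family n (p n) (x n) (\<F> n) (1 - \<alpha> n)"
      and p: "filterlim p at_top sequentially"
      and Mo: "moment_condition q p x F\<^sub>0 \<F>"
      and Ra: "rate_condition q p \<alpha>"
    have design: "normalized_design n (p n) (x n)" and F0: "standardized_law (F\<^sub>0 n)"
      and p1: "1 \<le> p n" if "1 \<le> n" for n
      using R that by (auto simp: regression_model_def normalized_design_def)
    have law: "standardized_law F" if "1 \<le> n" "F \<in> \<F> n" for n F
      using \<F> that by (auto simp: law_family_def)
    have q: "2 < q" and F0m: "F\<^sub>0 n \<in> \<F> n" if "1 \<le> n" for n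
      using Mo that by (auto simp: moment_condition_def)
    have q: "2 < q" by (rule q[of 1]) simp
    have "\<exists>C\<ge>1. (\<forall>n\<ge>1. \<forall>F\<in>\<F> n. integrable F (\<lambda>t. \<bar>t\<bar> powr q) \<and> integral\<^sup>L F (\<lambda>t. \<bar>t\<bar> powr q) \<le> C)
        \<and> (\<forall>n\<ge>1. \<forall>j\<in>{1..p n}. empirical_mean n (\<lambda>i. \<bar>x n i j\<bar> powr q) \<le> C)"
      using Mo law by (rule moment_condition_uniform_bound)
    then obtain C where C: "1 \<le> C"
      and iq: "\<And>n F. 1 \<le> n \<Longrightarrow> F \<in> \<F> n \<Longrightarrow> integrable F (\<lambda>t. \<bar>t\<bar> powr q)"
      and Cq: "\<And>n F. 1 \<le> n \<Longrightarrow> F \<in> \<F> n \<Longrightarrow> integral\<^sup>L F (\<lambda>t. \<bar>t\<bar> powr q) \<le> C"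
      and xq: "\<And>n j. 1 \<le> n \<Longrightarrow> j \<in> {1..p n} \<Longrightarrow> empirical_mean n (\<lambda>i. \<bar>x n i j\<bar> powr q) \<le> C"
      by blast
    obtain \<eta> where \<eta>: "0 < \<eta>" "\<eta> < 1"
      and rate: "\<forall>\<^sub>F n in sequentially. real (p n) \<le> \<alpha> n * real n powr (\<eta> * (q - 2) / 2) / 2"
      using Ra by (auto simp: rate_condition_def)
    have \<alpha>': "0 < \<alpha> n \<and> \<alpha> n < 1" if "1 \<le> n" for n using \<alpha> that by simp

    have \<alpha>2: "0 < \<alpha> n / 2 \<and> \<alpha> n / 2 < 1" if "1 \<le> n" for n using \<alpha>'[OF that] by simp

    \<comment> \<open>Coverage of the asymptotic option\<close>
    define P where "P = (\<lambda>n. \<P>(\<omega> in M n. c * asymptotic_quantile n (p n) (\<alpha> n)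
                        \<ge> c * score_stat n (p n) (x n) (\<lambda>i. \<epsilon> n i \<omega>)))"
    \<comment> \<open>The positive part of the shortfall: the inequality then holds for every n, and
      only the order of \<open>r\<close> remains to be shown.\<close>
    define r where "r = (\<lambda>n. max 0 (1 - \<alpha> n - P n))"
    have "r \<in> o(\<alpha>)"
    proof (rule landau_o.smallI)
      fix e :: real assume e: "0 < e"
      have "\<forall>\<^sub>F n in sequentially. 1 - cdf (score_law n (p n) (x n) (F\<^sub>0 n))
          (asymptotic_quantile n (p n) (\<alpha> n)) \<le> \<alpha> n * (1 + e)"
        by (rule asymptotic_tail_bound[OF q C \<eta> design F0 iq[OF _ F0m] Cq[OF _ F0m] xq \<alpha>' p rate e])
      then show "\<forall>\<^sub>F n in sequentially. norm (r n) \<le> e * norm (\<alpha> n)"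
        using eventually_ge_at_top[of 1]
      proof eventually_elim
        case (elim n)
        have "P n = cdf (score_law n (p n) (x n) (F\<^sub>0 n)) (asymptotic_quantile n (p n) (\<alpha> n))"
          unfolding P_def using R elim c by (intro regression_model_prob) auto
        then have "1 - \<alpha> n - P n \<le> e * \<alpha> n"
          using elim(1) by (simp add: algebra_simps)
        then show ?case
          using \<alpha>'[OF elim(2)] e by (simp add: r_def)
      qed
    qed
    moreover have "\<forall>n\<ge>1. P n \<ge> 1 - \<alpha> n - r n"
      by (auto simp: r_def max_def)
    ultimately show "\<exists>r. r \<in> o(\<alpha>) \<and>
          (\<forall>n\<ge>1. \<P>(\<omega> in M n. c * asymptotic_quantile n (p n) (\<alpha> n)
                        \<ge> c * score_stat n (p n) (x n) (\<lambda>i. \<epsilon> n i \<omega>)) \<ge> 1 - \<alpha> n - r n)"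
      unfolding P_def by blast

    \<comment> \<open>Comparison of the semi-exact with the asymptotic option\<close>
    define Q where "Q = (\<lambda>n. max_score_quantile n (p n) (x n) (\<F> n) (1 - \<alpha> n))"
    define A where "A = (\<lambda>n. asymptotic_quantile n (p n) (\<alpha> n))"
    define s where "s = (\<lambda>n. max 0 (Q n / A n - 1))"
    \<comment> \<open>Fixing a maximizing law for each n turns the maximum over the family into a
      sequence of laws to which the tail bound applies.\<close>
    have "\<exists>F\<in>\<F> n. Q n = score_quantile n (p n) (x n) F (1 - \<alpha> n)" if "1 \<le> n" for n
    proof -
      have "max_well_defined n (p n) (x n) (\<F> n) (1 - \<alpha> n)"
        using \<F> that by (simp add: law_family_def)
      then show ?thesis
        unfolding Q_def by (rule max_score_quantile_attained) blast
    qed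
    then obtain F where F: "\<And>n. 1 \<le> n \<Longrightarrow> F n \<in> \<F> n"
      and Q: "\<And>n. 1 \<le> n \<Longrightarrow> Q n = score_quantile n (p n) (x n) (F n) (1 - \<alpha> n)"
      by metis
    \<comment> \<open>The exponent is raised strictly between \<eta> and 1, so that a positive power
      of n absorbs the factor 2 lost by halving \<alpha>.\<close>
    define \<eta>' where "\<eta>' = (1 + \<eta>) / 2"
    have \<eta>': "0 < \<eta>'" "\<eta>' < 1" using \<eta> by (auto simp: \<eta>'_def)
    have rate': "\<forall>\<^sub>F n in sequentially. real (p n) \<le> (\<alpha> n / 2) * real n powr (\<eta>' * (q - 2) / 2) / 2"
    proof -
      define k where "k = (1 - \<eta>) * (q - 2) / 4"
      have k: "0 < k" using \<eta> q by (simp add: k_def)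
      have "\<forall>\<^sub>F n in sequentially. 2 \<le> real n powr k"
        using k by real_asymp
      then show ?thesis
        using rate eventually_ge_at_top[of 1]
      proof eventually_elim
        case (elim n)
        have "\<alpha> n * real n powr (\<eta> * (q - 2) / 2) * 2 \<le> \<alpha> n * real n powr (\<eta> * (q - 2) / 2) * real n powr k"
          using elim \<alpha>'[of n] by (intro mult_left_mono) auto
        also have "\<dots> = \<alpha> n * real n powr (\<eta>' * (q - 2) / 2)"
        proof -
          have "\<eta>' * (q - 2) / 2 = \<eta> * (q - 2) / 2 + k"
            by (simp add: \<eta>'_def k_def field_simps)
          then show ?thesis by (simp only: powr_add mult.assoc)
        qed
        finally show ?case using elim(2) by simp
      qed
    qed
    have Q_le: "\<forall>\<^sub>F n in sequentially. Q n \<le> asymptotic_quantile n (p n) (\<alpha> n / 2)"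
    proof -
      \<comment> \<open>At level \<alpha> / 2 with relative error 1 the tail is at most \<alpha>, so
        this point lies at or above the 1 - \<alpha> quantile.\<close>
      have "\<forall>\<^sub>F n in sequentially. 1 - cdf (score_law n (p n) (x n) (F n))
          (asymptotic_quantile n (p n) (\<alpha> n / 2)) \<le> \<alpha> n / 2 * (1 + 1)"
        by (rule asymptotic_tail_bound[OF q C \<eta>' design law[OF _ F] iq[OF _ F] Cq[OF _ F] xq \<alpha>2 p rate'])
          simp_all
      then show ?thesis
        using eventually_ge_at_top[of 1]
      proof eventually_elim
        case (elim n)
        then show ?case
          unfolding Q[OF elim(2)] score_quantile_def using \<alpha>'[OF elim(2)]
          by (intro cdf_quantile_ge(2)[OF real_distribution_score_law[OF law[OF elim(2) F[OF elim(2)]] p1[OF elim(2)]]]) auto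
      qed
    qed
    have A0: "0 < A n" if "1 \<le> n" for n
      unfolding A_def using asymptotic_quantile_bounds(1)[OF that p1[OF that]] \<alpha>'[OF that] by simp
    have "s \<in> o(\<lambda>_. 1)"
    proof (rule landau_o.smallI)
      fix e :: real assume e: "0 < e"
      have "\<forall>\<^sub>F n in sequentially.
          asymptotic_quantile n (p n) (\<alpha> n / 2) \<le> asymptotic_quantile n (p n) (\<alpha> n) * (1 + e)"
        using \<alpha>' p1 p e by (rule asymptotic_quantile_half)
      with Q_le show "\<forall>\<^sub>F n in sequentially. norm (s n) \<le> e * norm (1::real)"
        using eventually_ge_at_top[of 1]
      proof eventually_elim
        case (elim n)
        then have "Q n \<le> A n * (1 + e)" by (simp add: A_def)
        then have "Q n / A n - 1 \<le> e"
          using A0[OF elim(3)] by (simp add: field_simps)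
        then show ?case using e by (simp add: s_def)
      qed
    qed
    \<comment> \<open>The same \<open>s\<close> serves as both error terms, since the second
      inequality is the explicit bound on the asymptotic quantile times 1 + s n.\<close>
    moreover have "Q n \<le> A n * (1 + s n) \<and>
        A n * (1 + s n) \<le> sqrt (2 * real n * ln (2 * real (p n) / \<alpha> n)) * (1 + s n)" if "1 \<le> n" for n
    proof
      have "Q n = A n * (1 + (Q n / A n - 1))" using A0[OF that] by simp
      also have "\<dots> \<le> A n * (1 + s n)"
        using A0[OF that] by (intro mult_left_mono) (auto simp: s_def)
      finally show "Q n \<le> A n * (1 + s n)" .
      show "A n * (1 + s n) \<le> sqrt (2 * real n * ln (2 * real (p n) / \<alpha> n)) * (1 + s n)"
        unfolding A_def using asymptotic_quantile_bounds(2)[OF that p1[OF that]] \<alpha>'[OF that]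
        by (intro mult_right_mono) (auto simp: s_def)
    qed
    ultimately show "\<exists>r s. r \<in> o(\<lambda>_. 1) \<and> s \<in> o(\<lambda>_. 1) \<and>
          (\<forall>n\<ge>1.
            max_score_quantile n (p n) (x n) (\<F> n) (1 - \<alpha> n)
              \<le> asymptotic_quantile n (p n) (\<alpha> n) * (1 + r n) \<and>
            asymptotic_quantile n (p n) (\<alpha> n) * (1 + r n)
              \<le> sqrt (2 * real n * ln (2 * real (p n) / \<alpha> n)) * (1 + s n))"
      unfolding Q_def A_def by blast
  qed
qed

end
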